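(* Let $P$ be a smooth manifold. Two regular almost Dirac structures $L_1,L_2\subset TP\oplus T^*P$ are gauge related if and only if $\mathrm{pr}_1(L_1)=\mathrm{pr}_1(L_2)$.
   Context: An almost Dirac structure on $P$ is a subbundle $L\subset TP\oplus T^*P$ that is maximal isotropic for the pairing $\langle(X,\alpha),(Y,\beta)\rangle=\alpha(Y)+\beta(X)$; it is regular if $\mathrm{pr}_1(L)\subset TP$ has constant rank, where $\mathrm{pr}_1$ is the projection to $TP$. For a 2-form $B$ on $P$, the gauge transformation of $L$ by $B$ is the almost Dirac structure $\tau_B(L)=\{(X,\alpha+\mathbf{i}_XB):(X,\alpha)\in L\}$. $L_1$ and $L_2$ are gauge related if there exists a 2-form $B$ on $P$ with $\tau_B(L_1)=L_2$. *)

theory Defs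
  imports "HOL-Analysis.Analysis" "HOL-Library.Function_Algebras"
begin

text \<open>Functions into a real vector space form a real vector space pointwise. Points of $R^n$,
  tangent vectors and covectors are all represented by functions, so that \<open>subspace\<close>, \<open>span\<close>,
  \<open>independent\<close> and \<open>dim\<close> of the library apply to them.\<close>

instantiation "fun" :: (type, real_vector) real_vector
begin

definition scaleR_fun :: "real \<Rightarrow> ('a \<Rightarrow> 'b) \<Rightarrow> 'a \<Rightarrow> 'b" where
  "scaleR_fun r f = (\<lambda>x. r *\<^sub>R f x)"

instance
  by standard (simp_all add: scaleR_fun_def fun_eq_iff algebra_simps)

end

section \<open>Smooth functions on open subsets of \<open>Euclidean_space n\<close>\<close>

definition partial_deriv :: "nat \<Rightarrow> ((nat \<Rightarrow> real) \<Rightarrow> real) \<Rightarrow> (nat \<Rightarrow> real) \<Rightarrow> real" where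
  "partial_deriv i f x = deriv (\<lambda>t. f (x(i := t))) (x i)"

text \<open>\<open>U\<close> is meant to be open in \<open>Euclidean_space n\<close>, so that the values of \<open>f\<close> outside \<open>U\<close> do not
  matter. The type class topology on \<open>nat \<Rightarrow> real\<close> is the product topology, which induces that of
  \<open>Euclidean_space n\<close>.\<close>

primrec Ck_on :: "nat \<Rightarrow> nat \<Rightarrow> (nat \<Rightarrow> real) set \<Rightarrow> ((nat \<Rightarrow> real) \<Rightarrow> real) \<Rightarrow> bool" where
  "Ck_on n 0 U f \<longleftrightarrow> continuous_on U f"
| "Ck_on n (Suc k) U f \<longleftrightarrow> continuous_on U f \<and>
     (\<forall>i<n. (\<forall>x\<in>U. (\<lambda>t. f (x(i := t))) differentiable (at (x i))) \<and>
            Ck_on n k U (partial_deriv i f))"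

definition smooth_on :: "nat \<Rightarrow> (nat \<Rightarrow> real) set \<Rightarrow> ((nat \<Rightarrow> real) \<Rightarrow> real) \<Rightarrow> bool" where
  "smooth_on n U f \<longleftrightarrow> (\<forall>k. Ck_on n k U f)"

section \<open>Smooth manifolds\<close>

text \<open>A chart is a domain together with a coordinate map, whose values outside the domain are
  irrelevant.\<close>

type_synonym 'a chart = "'a set \<times> ('a \<Rightarrow> nat \<Rightarrow> real)"

record 'a manifold =
  man_top :: "'a topology"
  man_dim :: nat
  man_atlas :: "'a chart set"

definition chart_inv :: "'a chart \<Rightarrow> (nat \<Rightarrow> real) \<Rightarrow> 'a" where
  "chart_inv c = inv_into (fst c) (snd c)"

definition transition :: "'a chart \<Rightarrow> 'a chart \<Rightarrow> (nat \<Rightarrow> real) \<Rightarrow> nat \<Rightarrow> real" where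
  "transition c c' = snd c' \<circ> chart_inv c"

text \<open>The atlas need not be maximal; \<open>man_dim M = 0\<close> is allowed.\<close>

definition smooth_manifold :: "'a manifold \<Rightarrow> bool" where
  "smooth_manifold M \<longleftrightarrow>
     Hausdorff_space (man_top M) \<and> second_countable (man_top M) \<and>
     (\<Union>c\<in>man_atlas M. fst c) = topspace (man_top M) \<and>
     (\<forall>c\<in>man_atlas M.
        openin (man_top M) (fst c) \<and> openin (Euclidean_space (man_dim M)) (snd c ` fst c) \<and>
        homeomorphic_map (subtopology (man_top M) (fst c))
          (subtopology (Euclidean_space (man_dim M)) (snd c ` fst c)) (snd c)) \<and>
     (\<forall>c\<in>man_atlas M. \<forall>c'\<in>man_atlas M. \<forall>i<man_dim M.
        smooth_on (man_dim M) (snd c ` (fst c \<inter> fst c')) (\<lambda>x. transition c c' x i))"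

text \<open>Here \<open>U\<close> is meant to be open in \<open>M\<close>.\<close>

definition smooth_fun :: "'a manifold \<Rightarrow> 'a set \<Rightarrow> ('a \<Rightarrow> real) \<Rightarrow> bool" where
  "smooth_fun M U f \<longleftrightarrow>
     (\<forall>c\<in>man_atlas M. smooth_on (man_dim M) (snd c ` (U \<inter> fst c)) (f \<circ> chart_inv c))"

definition charts_at :: "'a manifold \<Rightarrow> 'a \<Rightarrow> 'a chart set" where
  "charts_at M p = {c \<in> man_atlas M. p \<in> fst c}"

text \<open>A tangent vector at \<open>p\<close> is the family of its coordinate vectors in the charts around \<open>p\<close>,
  related by the Jacobian matrices of the coordinate changes. It is extended by \<open>0\<close> to all other
  charts.\<close>

type_synonym 'a tangent = "'a chart \<Rightarrow> nat \<Rightarrow> real"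
type_synonym 'a cotangent = "'a tangent \<Rightarrow> real"

definition tangent_space :: "'a manifold \<Rightarrow> 'a \<Rightarrow> 'a tangent set" where
  "tangent_space M p = {v.
     (\<forall>c. c \<notin> charts_at M p \<longrightarrow> v c = 0) \<and>
     (\<forall>c\<in>charts_at M p. v c \<in> topspace (Euclidean_space (man_dim M))) \<and>
     (\<forall>c\<in>charts_at M p. \<forall>c'\<in>charts_at M p. \<forall>i<man_dim M.
        v c' i = (\<Sum>j<man_dim M. partial_deriv j (\<lambda>x. transition c c' x i) (snd c p) * v c j))}"

text \<open>Linear functionals on \<open>tangent_space M p\<close>, extended by \<open>0\<close> outside of it.\<close>

definition cotangent_space :: "'a manifold \<Rightarrow> 'a \<Rightarrow> 'a cotangent set" where
  "cotangent_space M p = {\<alpha>.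
     (\<forall>X\<in>tangent_space M p. \<forall>Y\<in>tangent_space M p. \<alpha> (X + Y) = \<alpha> X + \<alpha> Y) \<and>
     (\<forall>r. \<forall>X\<in>tangent_space M p. \<alpha> (r *\<^sub>R X) = r * \<alpha> X) \<and>
     (\<forall>X. X \<notin> tangent_space M p \<longrightarrow> \<alpha> X = 0)}"

definition smooth_vector_field :: "'a manifold \<Rightarrow> 'a set \<Rightarrow> ('a \<Rightarrow> 'a tangent) \<Rightarrow> bool" where
  "smooth_vector_field M U X \<longleftrightarrow>
     (\<forall>p\<in>U. X p \<in> tangent_space M p) \<and>
     (\<forall>c\<in>man_atlas M. \<forall>i<man_dim M. smooth_fun M (U \<inter> fst c) (\<lambda>p. X p c i))"

definition smooth_1form :: "'a manifold \<Rightarrow> 'a set \<Rightarrow> ('a \<Rightarrow> 'a cotangent) \<Rightarrow> bool" where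
  "smooth_1form M U \<alpha> \<longleftrightarrow>
     (\<forall>p\<in>U. \<alpha> p \<in> cotangent_space M p) \<and>
     (\<forall>V X. openin (man_top M) V \<and> V \<subseteq> U \<and> smooth_vector_field M V X
        \<longrightarrow> smooth_fun M V (\<lambda>p. \<alpha> p (X p)))"

text \<open>A 2-form is given by its contractions: \<open>B p X\<close> is the covector \<open>i_X B = B(X, -)\<close> at \<open>p\<close>.
  Values of \<open>B p X\<close> for \<open>X\<close> outside the tangent space at \<open>p\<close> are irrelevant.\<close>

definition smooth_2form :: "'a manifold \<Rightarrow> ('a \<Rightarrow> 'a tangent \<Rightarrow> 'a cotangent) \<Rightarrow> bool" where
  "smooth_2form M B \<longleftrightarrow>
     (\<forall>p\<in>topspace (man_top M).
        (\<forall>X\<in>tangent_space M p. B p X \<in> cotangent_space M p) \<and>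
        (\<forall>X\<in>tangent_space M p. \<forall>Y\<in>tangent_space M p. B p (X + Y) = B p X + B p Y) \<and>
        (\<forall>r. \<forall>X\<in>tangent_space M p. B p (r *\<^sub>R X) = r *\<^sub>R B p X) \<and>
        (\<forall>X\<in>tangent_space M p. B p X X = 0)) \<and>
     (\<forall>V X Y. openin (man_top M) V \<and> smooth_vector_field M V X \<and> smooth_vector_field M V Y
        \<longrightarrow> smooth_fun M V (\<lambda>p. B p (X p) (Y p)))"

section \<open>Dirac structures\<close>

text \<open>Subsets \<open>L\<close> of \<open>TP \<oplus> T*P\<close> and of \<open>TP\<close> are sets of elements \<open>(p, X, \<alpha>)\<close> and \<open>(p, X)\<close>,
  respectively; the fibre over \<open>p\<close> is \<open>L `` {p}\<close>.\<close>

definition double_bundle :: "'a manifold \<Rightarrow> ('a \<times> 'a tangent \<times> 'a cotangent) set" where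
  "double_bundle M = (SIGMA p : topspace (man_top M). tangent_space M p \<times> cotangent_space M p)"

definition subbundle :: "'a manifold \<Rightarrow> ('a \<times> 'a tangent \<times> 'a cotangent) set \<Rightarrow> bool" where
  "subbundle M L \<longleftrightarrow> L \<subseteq> double_bundle M \<and>
     (\<forall>p\<in>topspace (man_top M). \<exists>U k s. openin (man_top M) U \<and> p \<in> U \<and>
        (\<forall>i<k. smooth_vector_field M U (\<lambda>q. fst (s i q)) \<and>
               smooth_1form M U (\<lambda>q. snd (s i q))) \<and>
        (\<forall>q\<in>U. inj_on (\<lambda>i::nat. s i q) {..<k} \<and> independent ((\<lambda>i. s i q) ` {..<k}) \<and>
               span ((\<lambda>i. s i q) ` {..<k}) = L `` {q}))"

definition dirac_pairing :: "'a tangent \<times> 'a cotangent \<Rightarrow> 'a tangent \<times> 'a cotangent \<Rightarrow> real" where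
  "dirac_pairing = (\<lambda>(X, \<alpha>) (Y, \<beta>). \<alpha> Y + \<beta> X)"

definition isotropic :: "('a tangent \<times> 'a cotangent) set \<Rightarrow> bool" where
  "isotropic W \<longleftrightarrow> (\<forall>u\<in>W. \<forall>w\<in>W. dirac_pairing u w = 0)"

definition maximal_isotropic ::
    "'a manifold \<Rightarrow> 'a \<Rightarrow> ('a tangent \<times> 'a cotangent) set \<Rightarrow> bool" where
  "maximal_isotropic M p W \<longleftrightarrow>
     subspace W \<and> W \<subseteq> tangent_space M p \<times> cotangent_space M p \<and> isotropic W \<and>
     (\<forall>W'. subspace W' \<and> W' \<subseteq> tangent_space M p \<times> cotangent_space M p \<and> isotropic W' \<and> W \<subseteq> W'
        \<longrightarrow> W' = W)"

definition almost_dirac :: "'a manifold \<Rightarrow> ('a \<times> 'a tangent \<times> 'a cotangent) set \<Rightarrow> bool" where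
  "almost_dirac M L \<longleftrightarrow>
     subbundle M L \<and> (\<forall>p\<in>topspace (man_top M). maximal_isotropic M p (L `` {p}))"

definition pr1 :: "('a \<times> 'a tangent \<times> 'a cotangent) set \<Rightarrow> ('a \<times> 'a tangent) set" where
  "pr1 L = (\<lambda>(p, X, \<alpha>). (p, X)) ` L"

definition regular_dirac :: "'a manifold \<Rightarrow> ('a \<times> 'a tangent \<times> 'a cotangent) set \<Rightarrow> bool" where
  "regular_dirac M L \<longleftrightarrow>
     almost_dirac M L \<and> (\<exists>r. \<forall>p\<in>topspace (man_top M). dim (pr1 L `` {p}) = r)"

definition gauge_transform ::
    "('a \<Rightarrow> 'a tangent \<Rightarrow> 'a cotangent) \<Rightarrow> ('a \<times> 'a tangent \<times> 'a cotangent) set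
      \<Rightarrow> ('a \<times> 'a tangent \<times> 'a cotangent) set" where
  "gauge_transform B L = {(p, X, \<alpha> + B p X) | p X \<alpha>. (p, X, \<alpha>) \<in> L}"

definition gauge_related ::
    "'a manifold \<Rightarrow> ('a \<times> 'a tangent \<times> 'a cotangent) set
      \<Rightarrow> ('a \<times> 'a tangent \<times> 'a cotangent) set \<Rightarrow> bool" where
  "gauge_related M L\<^sub>1 L\<^sub>2 \<longleftrightarrow> (\<exists>B. smooth_2form M B \<and> gauge_transform B L\<^sub>1 = L\<^sub>2)"

end

theory Submission
  imports Defs
begin

text \<open>A maximal isotropic fibre is determined by its projection \<open>R\<close> and the skew form
  \<open>\<omega>(X, Y) = \<alpha>(Y)\<close> on \<open>R\<close>, since covectors annihilating \<open>R\<close> belong to it. Hence it suffices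
  to extend the form \<open>\<omega>\<^sub>i\<close> of each \<open>L\<^sub>i\<close> to a smooth 2-form \<open>B\<^sub>i\<close> on the manifold and to take
  \<open>B = B\<^sub>2 - B\<^sub>1\<close>. Locally, sections \<open>(X\<^sub>a, \<xi>\<^sub>a)\<close> of \<open>L\<^sub>i\<close> with \<open>X\<^sub>a\<close> an orthogonal frame of \<open>R\<close> for the
  Euclidean product \<open>g\<close> of a chart give the extension
  \<open>\<Sum>a b. \<xi>\<^sub>a(X\<^sub>b) * g(X\<^sub>a, Y) * g(X\<^sub>b, Z) / (g(X\<^sub>a, X\<^sub>a) * g(X\<^sub>b, X\<^sub>b))\<close>; constant rank guarantees that the
  frame spans \<open>R\<close> around a point. Extending \<open>\<omega>\<^sub>i\<close> is an affine condition, so that local extensions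
  glue by a partition of unity.\<close>

section \<open>Smooth functions\<close>

text \<open>The form is well defined on \<open>R\<close> because isotropy gives
  \<open>\<alpha>(Y) = - \<beta>(X)\<close> for every \<open>\<beta>\<close> over \<open>Y\<close>:
  the covector over \<open>X\<close> is ambiguous only up to the annihilator of \<open>R\<close>. By
  the choice of \<open>B\<close>, the covectors \<open>\<alpha>\<^sub>1 + i_X B\<close> and
  \<open>\<alpha>\<^sub>2\<close> over the same \<open>X\<close> agree on \<open>R\<close>, and this
  ambiguity absorbs their difference. The converse is immediate, since a gauge transformation leaves
  vector parts alone. The obstacle is smoothness: \<open>R\<close> is only a projection, and the
  vector parts of a frame of \<open>L\<close> are in general dependent. Gram-Schmidt is therefore
  run on sections of \<open>L\<close>, so that each \<open>X\<^sub>a\<close> keeps a smooth covector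
  \<open>\<xi>\<^sub>a\<close> over it and the coefficients \<open>\<xi>\<^sub>a(X\<^sub>b)\<close>
  are smooth. Orthogonal rather than orthonormal frames keep every formula rational. The product
  \<open>g\<close>, and with it the extension to vectors outside \<open>R\<close>, changes with the
  chart, but all extensions restrict to the same form on \<open>R\<close>.\<close>

lemma Euclidean_space_eq_top_of_set:
  "Euclidean_space n = top_of_set {x. \<forall>i\<ge>n. x i = 0}"
  by (simp add: Euclidean_space_def euclidean_product_topology)

text \<open>\<open>U\<close> is open only within the slice where coordinates from \<open>n\<close>
  on vanish; moving a coordinate below \<open>n\<close> stays in that slice. Hence partial
  derivatives at points of \<open>U\<close> depend only on the values on \<open>U\<close>.\<close>

lemma eventually_fun_upd_in_openin_Euclidean:
  assumes "openin (Euclidean_space n) U" "x \<in> U" "i < n"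
  shows "\<forall>\<^sub>F t in nhds (x i). x(i := t) \<in> U"
proof -
  obtain T where T: "open T" "U = {x. \<forall>i\<ge>n. x i = 0} \<inter> T"
    using assms(1) by (auto simp: Euclidean_space_eq_top_of_set openin_open)
  have "continuous_on UNIV (\<lambda>t. x(i := t))"
  proof (rule continuous_on_coordinatewise_then_product)
    show "continuous_on UNIV (\<lambda>t. (x(i := t)) j)" for j
      by (cases "j = i") auto
  qed
  then have "open ((\<lambda>t. x(i := t)) -` T)"
    by (rule open_vimage[OF T(1)])
  moreover have "x i \<in> (\<lambda>t. x(i := t)) -` T"
    using assms(2) T(2) by simp
  ultimately have "\<forall>\<^sub>F t in nhds (x i). t \<in> (\<lambda>t. x(i := t)) -` T"
    by (rule eventually_nhds_in_open)
  then show ?thesis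
    using assms(2,3) T(2) by (auto elim!: eventually_mono)
qed

lemma Ck_on_imp_continuous_on: "Ck_on n k U f \<Longrightarrow> continuous_on U f"
  by (cases k) auto

lemma Ck_on_subset: "Ck_on n k U f \<Longrightarrow> V \<subseteq> U \<Longrightarrow> Ck_on n k V f"
  by (induction k arbitrary: f) (auto intro: continuous_on_subset)

lemma Ck_on_Suc_imp: "Ck_on n (Suc k) U f \<Longrightarrow> Ck_on n k U f"
  by (induction k arbitrary: f) auto

lemma Ck_on_SucD:
  assumes "Ck_on n (Suc k) U f" "i < n"
  shows "\<And>x. x \<in> U \<Longrightarrow>
      ((\<lambda>t. f (x(i := t))) has_real_derivative partial_deriv i f x) (at (x i))"
    and "Ck_on n k U (partial_deriv i f)"
  using assms by (auto simp: partial_deriv_def DERIV_deriv_iff_real_differentiable)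

text \<open>Partial derivatives are local, so agreement on an open \<open>U\<close> passes to them;
  the induction hypothesis is applied to these derivatives, hence \<open>f\<close> and
  \<open>g\<close> are arbitrary.\<close>

lemma Ck_on_cong_imp:
  assumes "openin (Euclidean_space n) U" "\<And>x. x \<in> U \<Longrightarrow> f x = g x" "Ck_on n k U f"
  shows "Ck_on n k U g"
  using assms(2,3)
proof (induction k arbitrary: f g)
  case 0
  then show ?case
    using continuous_on_cong[of U U f g] by simp
next
  case (Suc k)
  have eq: "\<forall>\<^sub>F t in nhds (x i). f (x(i := t)) = g (x(i := t))" if "x \<in> U" "i < n" for x i
    using eventually_fun_upd_in_openin_Euclidean[OF assms(1) that] Suc.prems(1)
    by (auto elim!: eventually_mono)
  have der: "((\<lambda>t. g (x(i := t))) has_real_derivative partial_deriv i f x) (at (x i))"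
    if "x \<in> U" "i < n" for x i
    using Ck_on_SucD(1)[OF Suc.prems(2) that(2,1)] DERIV_cong_ev[OF refl eq[OF that] refl] by blast
  have "Ck_on n k U (partial_deriv i g)" if "i < n" for i
  proof (rule Suc.IH)
    show "Ck_on n k U (partial_deriv i f)"
      using Ck_on_SucD(2)[OF Suc.prems(2) that] .
    show "partial_deriv i f x = partial_deriv i g x" if "x \<in> U" for x
      using DERIV_imp_deriv[OF der[OF that \<open>i < n\<close>]] by (simp add: partial_deriv_def)
  qed
  moreover have "continuous_on U g"
    using Suc.prems continuous_on_cong[of U U f g] by simp
  ultimately show ?case
    using der by (auto simp: real_differentiable_def)
qed

text \<open>Any derivative formula \<open>D\<close> may stand in for \<open>partial_deriv\<close>,
  so that the closure rules for sums, products and inverses follow from the usual calculus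
  rules.\<close>

lemma Ck_on_SucI:
  assumes "openin (Euclidean_space n) U" "continuous_on U f"
    and der: "\<And>i x. i < n \<Longrightarrow> x \<in> U \<Longrightarrow>
      ((\<lambda>t. f (x(i := t))) has_real_derivative D i x) (at (x i))"
    and D: "\<And>i. i < n \<Longrightarrow> Ck_on n k U (D i)"
  shows "Ck_on n (Suc k) U f"
proof -
  have "Ck_on n k U (partial_deriv i f)" if "i < n" for i
    using that DERIV_imp_deriv[OF der[OF that]]
    by (intro Ck_on_cong_imp[OF assms(1) _ D[OF that]]) (simp add: partial_deriv_def)
  then show ?thesis
    using assms(2) der by (auto simp: real_differentiable_def)
qed

lemma Ck_on_const: "Ck_on n k U (\<lambda>x. a)"
proof (induction k arbitrary: a)
  case (Suc k)
  have "partial_deriv i (\<lambda>x. a) = (\<lambda>x. 0)" for i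
    by (simp add: partial_deriv_def fun_eq_iff)
  then show ?case
    using Suc by simp
qed simp

lemma Ck_on_add:
  assumes U: "openin (Euclidean_space n) U"
  shows "Ck_on n k U f \<Longrightarrow> Ck_on n k U g \<Longrightarrow> Ck_on n k U (\<lambda>x. f x + g x)"
proof (induction k arbitrary: f g)
  case (Suc k)
  show ?case
  proof (rule Ck_on_SucI[OF U])
    show "continuous_on U (\<lambda>x. f x + g x)"
      using Suc.prems by (intro continuous_intros) (auto dest: Ck_on_imp_continuous_on)
    fix i assume i: "i < n"
    show "Ck_on n k U (\<lambda>x. partial_deriv i f x + partial_deriv i g x)"
      using Suc i by (intro Suc.IH) (auto dest: Ck_on_SucD)
    show "((\<lambda>t. f (x(i := t)) + g (x(i := t))) has_real_derivative
        partial_deriv i f x + partial_deriv i g x) (at (x i))" if "x \<in> U" for x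
      using Ck_on_SucD(1)[OF Suc.prems(1) i that] Ck_on_SucD(1)[OF Suc.prems(2) i that]
      by (intro DERIV_add)
  qed
qed (auto intro!: continuous_intros)

lemma Ck_on_mult:
  assumes U: "openin (Euclidean_space n) U"
  shows "Ck_on n k U f \<Longrightarrow> Ck_on n k U g \<Longrightarrow> Ck_on n k U (\<lambda>x. f x * g x)"
proof (induction k arbitrary: f g)
  case (Suc k)
  show ?case
  proof (rule Ck_on_SucI[OF U])
    show "continuous_on U (\<lambda>x. f x * g x)"
      using Suc.prems by (intro continuous_intros) (auto dest: Ck_on_imp_continuous_on)
    fix i assume i: "i < n"
    show "Ck_on n k U (\<lambda>x. f x * partial_deriv i g x + partial_deriv i f x * g x)"
      using Suc.prems[THEN Ck_on_Suc_imp] Suc.prems[THEN Ck_on_SucD(2), OF i]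
      by (intro Ck_on_add[OF U] Suc.IH)
    show "((\<lambda>t. f (x(i := t)) * g (x(i := t))) has_real_derivative
        f x * partial_deriv i g x + partial_deriv i f x * g x) (at (x i))" if "x \<in> U" for x
      by (rule DERIV_cong[OF DERIV_mult'[OF Ck_on_SucD(1)[OF Suc.prems(1) i that]
          Ck_on_SucD(1)[OF Suc.prems(2) i that]]]) simp
  qed
qed (auto intro!: continuous_intros)

text \<open>The derivative of \<open>1 / f\<close> is a product of that of \<open>f\<close> with two
  copies of \<open>1 / f\<close> itself, so order \<open>k\<close> of the inverse suffices for order
  \<open>k + 1\<close> and \<open>f\<close> can stay fixed.\<close>

lemma Ck_on_inverse:
  assumes U: "openin (Euclidean_space n) U" and nz: "\<And>x. x \<in> U \<Longrightarrow> f x \<noteq> 0"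
  shows "Ck_on n k U f \<Longrightarrow> Ck_on n k U (\<lambda>x. inverse (f x))"
proof (induction k)
  case (Suc k)
  show ?case
  proof (rule Ck_on_SucI[OF U])
    show "continuous_on U (\<lambda>x. inverse (f x))"
      using Suc.prems nz by (intro continuous_intros) (auto dest: Ck_on_imp_continuous_on)
    fix i assume i: "i < n"
    show "Ck_on n k U (\<lambda>x. (- 1) * (inverse (f x) * partial_deriv i f x * inverse (f x)))"
      using Suc.IH Ck_on_Suc_imp[OF Suc.prems] Ck_on_SucD(2)[OF Suc.prems i]
      by (intro Ck_on_mult[OF U] Ck_on_const)
    show "((\<lambda>t. inverse (f (x(i := t)))) has_real_derivative
        (- 1) * (inverse (f x) * partial_deriv i f x * inverse (f x))) (at (x i))" if "x \<in> U" for x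
      by (rule DERIV_cong[OF DERIV_inverse'[OF Ck_on_SucD(1)[OF Suc.prems i that]]])
        (simp_all add: nz[OF that])
  qed
qed (auto intro!: continuous_intros nz)

text \<open>Relative openness of \<open>W\<close> makes limits within \<open>W\<close> and within
  \<open>U\<close> agree. Partial derivatives are taken along whole coordinate lines and carry over
  pointwise.\<close>

lemma Ck_on_local:
  assumes "\<And>x. x \<in> U \<Longrightarrow> \<exists>W. openin (top_of_set U) W \<and> x \<in> W \<and> Ck_on n k W f"
  shows "Ck_on n k U f"
  using assms
proof (induction k arbitrary: f)
  have cont: "continuous_on U g"
    if loc: "\<And>x. x \<in> U \<Longrightarrow> \<exists>W. openin (top_of_set U) W \<and> x \<in> W \<and> continuous_on W g"
    for g :: "(nat \<Rightarrow> real) \<Rightarrow> real"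
    unfolding continuous_on_eq_continuous_within
  proof
    fix x assume "x \<in> U"
    then obtain W where W: "openin (top_of_set U) W" "x \<in> W" "continuous_on W g"
      using loc by blast
    then obtain T where T: "open T" "W = U \<inter> T"
      by (auto simp: openin_open)
    have "at x within W = at x within U"
      using T W(2) by (intro at_within_nhd[of x T]) auto
    then show "continuous (at x within U) g"
      using W by (auto simp: continuous_on_eq_continuous_within continuous_within)
  qed
  { case 0
    then show ?case using cont by simp
  next
    case (Suc k)
    have "continuous_on U f"
      using Suc.prems by (intro cont) (meson Ck_on_imp_continuous_on)
    moreover have "(\<lambda>t. f (x(i := t))) differentiable at (x i)" if "x \<in> U" "i < n" for x i
      using Suc.prems[OF that(1)] that(2) by auto
    moreover have "Ck_on n k U (partial_deriv i f)" if "i < n" for i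
      using Suc.prems that by (intro Suc.IH) (meson Ck_on_SucD(2))
    ultimately show ?case by simp }
qed

text \<open>The functions \<open>x \<mapsto> x\<^sup>-\<^sup>j exp (-1/x)\<close> for \<open>x > 0\<close>, extended by \<open>0\<close>. The family is closed
  under differentiation up to linear combinations, so that no polynomials have to be tracked.\<close>

definition flat_exp :: "nat \<Rightarrow> real \<Rightarrow> real" where
  "flat_exp j x = (if x > 0 then inverse x ^ j * exp (- inverse x) else 0)"

lemma tendsto_flat_exp_at_right_0: "((\<lambda>x. flat_exp j x) \<longlongrightarrow> 0) (at_right 0)"
proof -
  have "((\<lambda>y. y ^ j / exp y) \<longlongrightarrow> (0::real)) at_top"
    by (rule tendsto_power_div_exp_0)
  then have "((\<lambda>x. inverse x ^ j / exp (inverse x)) \<longlongrightarrow> (0::real)) (at_right 0)"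
    by (rule filterlim_compose[OF _ filterlim_inverse_at_top_right])
  then show ?thesis
    by (rule Lim_transform_eventually)
      (auto simp: eventually_at_right_less flat_exp_def exp_minus divide_inverse
        intro!: eventually_at_rightI[of 0 1])
qed

lemma has_real_derivative_flat_exp:
  "(flat_exp j has_real_derivative flat_exp (j + 2) x - real j * flat_exp (j + 1) x) (at x)"
proof -
  consider "x > 0" | "x < 0" | "x = 0" by linarith
  then show ?thesis
  proof cases
    case 1
    have "((\<lambda>x. inverse x ^ j * exp (- inverse x)) has_real_derivative
        inverse x ^ j * (exp (- inverse x) * (inverse x * inverse x)) +
        (real j * inverse x ^ (j - 1) * (- (inverse x * inverse x))) * exp (- inverse x)) (at x)"
      using 1 by (auto intro!: derivative_eq_intros)
    \<comment> \<open>For \<open>j = 0\<close> the truncated exponent \<open>j - 1\<close> is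
      harmless, being multiplied by \<open>real j = 0\<close>.\<close>
    moreover have "inverse x ^ j * (exp (- inverse x) * (inverse x * inverse x)) +
        (real j * inverse x ^ (j - 1) * (- (inverse x * inverse x))) * exp (- inverse x)
        = flat_exp (j + 2) x - real j * flat_exp (j + 1) x"
      using 1 by (cases j) (simp_all add: flat_exp_def algebra_simps)
    ultimately have "((\<lambda>x. inverse x ^ j * exp (- inverse x)) has_real_derivative
        flat_exp (j + 2) x - real j * flat_exp (j + 1) x) (at x)"
      by (rule DERIV_cong)
    moreover have "\<forall>\<^sub>F y in nhds x. inverse y ^ j * exp (- inverse y) = flat_exp j y"
      using eventually_nhds_in_open[of "{0<..}" x] 1
      by (auto simp: flat_exp_def elim!: eventually_mono)
    ultimately show ?thesis
      by (rule DERIV_cong_ev[OF refl _ refl, THEN iffD1, rotated])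
  next
    case 2
    have "\<forall>\<^sub>F y in nhds x. 0 = flat_exp j y"
      using eventually_nhds_in_open[of "{..<0}" x] 2
      by (auto simp: flat_exp_def elim!: eventually_mono)
    then show ?thesis
      using 2 DERIV_cong_ev[OF refl, of "\<lambda>y. 0" "flat_exp j" x 0 0] by (simp add: flat_exp_def)
  next
    case 3
    \<comment> \<open>Dividing \<open>flat_exp j y\<close> by \<open>y > 0\<close> gives
      \<open>flat_exp (Suc j) y\<close>, so the limit at 0 already known for all exponents also
      yields the derivative there.\<close>
    have "((\<lambda>y. (flat_exp j y - flat_exp j 0) / (y - 0)) \<longlongrightarrow> 0) (at_right 0)"
      using tendsto_flat_exp_at_right_0[of "Suc j"]
      by (rule Lim_transform_eventually)
        (auto simp: flat_exp_def divide_inverse intro!: eventually_at_rightI[of 0 1])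
    moreover have "((\<lambda>y. (flat_exp j y - flat_exp j 0) / (y - 0)) \<longlongrightarrow> 0) (at_left 0)"
      by (rule tendsto_eventually)
        (auto simp: flat_exp_def intro!: eventually_at_leftI[of "-1" 0])
    ultimately show ?thesis
      using 3 by (simp add: has_field_derivative_iff filterlim_split_at flat_exp_def)
  qed
qed

text \<open>Differentiation leads to the exponents \<open>j + 1\<close> and \<open>j + 2\<close>,
  which is why the induction on \<open>k\<close> leaves \<open>j\<close> arbitrary.\<close>

lemma Ck_on_flat_exp:
  assumes U: "openin (Euclidean_space n) U"
  shows "Ck_on n k U f \<Longrightarrow> Ck_on n k U (\<lambda>x. flat_exp j (f x))"
proof (induction k arbitrary: j)
  have "continuous_on S (\<lambda>x. flat_exp j (f x))" if "continuous_on S f" for S j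
    using DERIV_continuous_on[OF DERIV_subset[OF has_real_derivative_flat_exp]] that
    by (intro continuous_on_compose2[of UNIV "flat_exp j" S f]) auto
  note cont = this
  { case 0
    then show ?case by (simp add: cont)
  next
    case (Suc k)
    show ?case
    proof (rule Ck_on_SucI[OF U])
      show "continuous_on U (\<lambda>x. flat_exp j (f x))"
        using Suc.prems by (intro cont) simp
      fix i assume i: "i < n"
      show "Ck_on n k U (\<lambda>x. (flat_exp (j + 2) (f x) + (- real j) * flat_exp (j + 1) (f x))
          * partial_deriv i f x)"
        using Suc.IH Ck_on_Suc_imp[OF Suc.prems] Ck_on_SucD(2)[OF Suc.prems i]
        by (intro Ck_on_mult[OF U] Ck_on_add[OF U] Ck_on_const)
      show "((\<lambda>t. flat_exp j (f (x(i := t)))) has_real_derivative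
          (flat_exp (j + 2) (f x) + (- real j) * flat_exp (j + 1) (f x)) * partial_deriv i f x)
          (at (x i))" if "x \<in> U" for x
        by (rule DERIV_cong[OF DERIV_chain2[OF has_real_derivative_flat_exp
          Ck_on_SucD(1)[OF Suc.prems i that]]]) simp
    qed }
qed

section \<open>Smooth functions on manifolds\<close>

locale smooth_mfd =
  fixes M :: "'a manifold"
  assumes smooth_manifold: "smooth_manifold M"
begin

lemma
  assumes "c \<in> man_atlas M"
  shows openin_chart_domain: "openin (man_top M) (fst c)"
    and openin_chart_range: "openin (Euclidean_space (man_dim M)) (snd c ` fst c)"
    and homeomorphic_map_chart: "homeomorphic_map (subtopology (man_top M) (fst c))
          (subtopology (Euclidean_space (man_dim M)) (snd c ` fst c)) (snd c)"
  using smooth_manifold assms unfolding smooth_manifold_def by auto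

lemma chart_domain_subset: "c \<in> man_atlas M \<Longrightarrow> fst c \<subseteq> topspace (man_top M)"
  by (rule openin_subset[OF openin_chart_domain])

lemma topspace_chart_domain:
  "c \<in> man_atlas M \<Longrightarrow> topspace (subtopology (man_top M) (fst c)) = fst c"
  using chart_domain_subset[of c] by (simp add: Int_absorb1)

lemma chart_exists:
  assumes "p \<in> topspace (man_top M)"
  obtains c where "c \<in> man_atlas M" "p \<in> fst c"
  using smooth_manifold assms unfolding smooth_manifold_def by blast

lemma inj_on_chart: "c \<in> man_atlas M \<Longrightarrow> inj_on (snd c) (fst c)"
  using homeomorphic_map_chart[of c] topspace_chart_domain[of c]
  by (auto dest: homeomorphic_imp_injective_map)

lemma chart_inv_chart: "c \<in> man_atlas M \<Longrightarrow> p \<in> fst c \<Longrightarrow> chart_inv c (snd c p) = p"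
  by (simp add: chart_inv_def inj_on_chart)

lemma openin_chart_image_iff:
  assumes c: "c \<in> man_atlas M" and U: "U \<subseteq> fst c"
  shows "openin (Euclidean_space (man_dim M)) (snd c ` U) \<longleftrightarrow> openin (man_top M) U"
proof -
  have "openin (subtopology (Euclidean_space (man_dim M)) (snd c ` fst c)) (snd c ` U) \<longleftrightarrow>
      openin (subtopology (man_top M) (fst c)) U"
    using homeomorphic_map_openness[OF homeomorphic_map_chart[OF c]] U
    unfolding topspace_chart_domain[OF c] by blast
  then show ?thesis
    using U openin_open_subtopology[OF openin_chart_range[OF c]]
      openin_open_subtopology[OF openin_chart_domain[OF c]] by auto
qed

lemma openin_chart_image:
  assumes "openin (man_top M) U" "c \<in> man_atlas M"
  shows "openin (Euclidean_space (man_dim M)) (snd c ` (U \<inter> fst c))"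
  using assms openin_chart_image_iff[of c "U \<inter> fst c"] openin_chart_domain[of c] by (simp add: openin_Int)

lemma smooth_fun_subset: "smooth_fun M U f \<Longrightarrow> V \<subseteq> U \<Longrightarrow> smooth_fun M V f"
  unfolding smooth_fun_def smooth_on_def by (meson Ck_on_subset Int_mono image_mono order_refl)

lemma smooth_fun_cong:
  assumes "openin (man_top M) U" "\<And>p. p \<in> U \<Longrightarrow> f p = g p" "smooth_fun M U f"
  shows "smooth_fun M U g"
  unfolding smooth_fun_def smooth_on_def
proof safe
  fix c k assume c: "c \<in> man_atlas M"
  show "Ck_on (man_dim M) k (snd c ` (U \<inter> fst c)) (g \<circ> chart_inv c)"
  proof (rule Ck_on_cong_imp[OF openin_chart_image[OF assms(1) c]])
    show "Ck_on (man_dim M) k (snd c ` (U \<inter> fst c)) (f \<circ> chart_inv c)"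
      using assms(3) c unfolding smooth_fun_def smooth_on_def by blast
  qed (auto simp: chart_inv_chart[OF c] assms(2))
qed

lemma smooth_fun_local:
  assumes loc: "\<And>p. p \<in> U \<Longrightarrow> \<exists>V. openin (man_top M) V \<and> p \<in> V \<and> V \<subseteq> U \<and> smooth_fun M V f"
  shows "smooth_fun M U f"
  unfolding smooth_fun_def smooth_on_def
proof safe
  fix c k assume c: "c \<in> man_atlas M"
  show "Ck_on (man_dim M) k (snd c ` (U \<inter> fst c)) (f \<circ> chart_inv c)"
  proof (rule Ck_on_local)
    fix x assume "x \<in> snd c ` (U \<inter> fst c)"
    then obtain p where p: "p \<in> U" "p \<in> fst c" "x = snd c p" by auto
    obtain V where V: "openin (man_top M) V" "p \<in> V" "V \<subseteq> U" "smooth_fun M V f"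
      using loc[OF p(1)] by blast
    obtain T where T: "open T" "snd c ` (V \<inter> fst c) = {x. \<forall>i\<ge>man_dim M. x i = 0} \<inter> T"
      using openin_chart_image[OF V(1) c] by (auto simp: Euclidean_space_eq_top_of_set openin_open)
    have "snd c ` (U \<inter> fst c) \<subseteq> {x. \<forall>i\<ge>man_dim M. x i = 0}"
      using openin_subset[OF openin_chart_range[OF c]]
      by (auto simp: Euclidean_space_eq_top_of_set)
    then have "snd c ` (V \<inter> fst c) = snd c ` (U \<inter> fst c) \<inter> T"
      using T(2) V(3) by blast
    then have "openin (top_of_set (snd c ` (U \<inter> fst c))) (snd c ` (V \<inter> fst c))"
      using T(1) by (auto simp: openin_open)
    then show "\<exists>W. openin (top_of_set (snd c ` (U \<inter> fst c))) W \<and> x \<in> W \<and>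
        Ck_on (man_dim M) k W (f \<circ> chart_inv c)"
      using V p c unfolding smooth_fun_def smooth_on_def by blast
  qed
qed

lemma smooth_fun_const: "smooth_fun M U (\<lambda>p. a)"
  unfolding smooth_fun_def smooth_on_def comp_def by (simp add: Ck_on_const)

lemma smooth_fun_add:
  assumes "openin (man_top M) U" "smooth_fun M U f" "smooth_fun M U g"
  shows "smooth_fun M U (\<lambda>p. f p + g p)"
  using assms unfolding smooth_fun_def smooth_on_def comp_def
  by (simp add: Ck_on_add openin_chart_image)

lemma smooth_fun_mult:
  assumes "openin (man_top M) U" "smooth_fun M U f" "smooth_fun M U g"
  shows "smooth_fun M U (\<lambda>p. f p * g p)"
  using assms unfolding smooth_fun_def smooth_on_def comp_def
  by (simp add: Ck_on_mult openin_chart_image)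

lemma smooth_fun_diff:
  assumes "openin (man_top M) U" "smooth_fun M U f" "smooth_fun M U g"
  shows "smooth_fun M U (\<lambda>p. f p - g p)"
  using smooth_fun_add[OF assms(1,2) smooth_fun_mult[OF assms(1) smooth_fun_const[of U "-1"] assms(3)]]
  by simp

lemma smooth_fun_divide:
  assumes "openin (man_top M) U" "smooth_fun M U f" "smooth_fun M U g" "\<And>p. p \<in> U \<Longrightarrow> g p \<noteq> 0"
  shows "smooth_fun M U (\<lambda>p. f p / g p)"
proof -
  have "smooth_fun M U (\<lambda>p. inverse (g p))"
    unfolding smooth_fun_def smooth_on_def comp_def
  proof safe
    fix c k assume c: "c \<in> man_atlas M"
    show "Ck_on (man_dim M) k (snd c ` (U \<inter> fst c)) (\<lambda>x. inverse (g (chart_inv c x)))"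
      using assms c openin_chart_image[OF assms(1) c]
      by (intro Ck_on_inverse) (auto simp: chart_inv_chart smooth_fun_def smooth_on_def comp_def)
  qed
  then show ?thesis
    using assms by (auto simp: divide_inverse intro: smooth_fun_mult)
qed

lemma smooth_fun_flat_exp:
  assumes "openin (man_top M) U" "smooth_fun M U f"
  shows "smooth_fun M U (\<lambda>p. flat_exp j (f p))"
  using assms unfolding smooth_fun_def smooth_on_def comp_def
  by (simp add: Ck_on_flat_exp openin_chart_image)

lemma smooth_fun_sum:
  assumes "openin (man_top M) U" "\<And>i. i \<in> I \<Longrightarrow> smooth_fun M U (f i)"
  shows "smooth_fun M U (\<lambda>p. \<Sum>i\<in>I. f i p)"
  using assms(2)
  by (induction I rule: infinite_finite_induct)
    (auto intro: smooth_fun_const smooth_fun_add[OF assms(1)])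

lemma smooth_fun_prod:
  assumes "openin (man_top M) U" "\<And>i. i \<in> I \<Longrightarrow> smooth_fun M U (f i)"
  shows "smooth_fun M U (\<lambda>p. \<Prod>i\<in>I. f i p)"
  using assms(2)
  by (induction I rule: infinite_finite_induct)
    (auto intro: smooth_fun_const smooth_fun_mult[OF assms(1)])

text \<open>Read in another chart \<open>c'\<close>, a coordinate of \<open>c\<close> is a component
  of the transition map from \<open>c'\<close> to \<open>c\<close>, which is smooth by compatibility
  of the atlas.\<close>

lemma smooth_fun_coordinate:
  assumes "c \<in> man_atlas M" "i < man_dim M"
  shows "smooth_fun M (fst c) (\<lambda>p. snd c p i)"
  using smooth_manifold assms
  unfolding smooth_manifold_def smooth_fun_def transition_def comp_def
  by (simp add: Int_commute)

text \<open>Serves to shrink neighbourhoods. Smoothness gives continuity only in charts, so the set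
  is shown to be open in the image of one chart and pulled back.\<close>

lemma openin_smooth_fun_nonzero:
  assumes c: "c \<in> man_atlas M" and V: "openin (man_top M) V" "V \<subseteq> fst c"
    and f: "smooth_fun M V f"
  shows "openin (man_top M) {q \<in> V. f q \<noteq> 0}"
proof -
  have V': "V \<inter> fst c = V" using V(2) by auto
  let ?g = "f \<circ> chart_inv c"
  have g: "?g (snd c q) = f q" if "q \<in> V" for q
    using that V(2) by (auto simp: chart_inv_chart[OF c])
  have "continuous_on (snd c ` V) ?g"
    using f c V' unfolding smooth_fun_def smooth_on_def
    by (metis Ck_on_imp_continuous_on)
  then have "openin (top_of_set (snd c ` V)) (snd c ` V \<inter> ?g -` (- {0}))"
    by (intro continuous_openin_preimage_gen) auto
  moreover have "snd c ` V \<inter> ?g -` (- {0}) = snd c ` {q \<in> V. f q \<noteq> 0}"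
    using g by auto
  ultimately have "openin (top_of_set (snd c ` V)) (snd c ` {q \<in> V. f q \<noteq> 0})"
    by simp
  moreover have "openin (Euclidean_space (man_dim M)) (snd c ` V)"
    using openin_chart_image[OF V(1) c] V' by simp
  ultimately have "openin (Euclidean_space (man_dim M)) (snd c ` {q \<in> V. f q \<noteq> 0})"
    unfolding Euclidean_space_eq_top_of_set by (rule openin_trans)
  then show ?thesis
    using openin_chart_image_iff[OF c, of "{q \<in> V. f q \<noteq> 0}"] V(2) by auto
qed

end

section \<open>Smooth cutoffs and bump functions\<close>

definition smooth_step :: "real \<Rightarrow> real" where
  "smooth_step t = flat_exp 0 (2 - t) / (flat_exp 0 (2 - t) + flat_exp 0 (t - 1))"

lemma flat_exp_nonneg: "0 \<le> flat_exp j x"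
  by (simp add: flat_exp_def)

lemma flat_exp_pos_iff: "0 < flat_exp j x \<longleftrightarrow> 0 < x"
  by (simp add: flat_exp_def)

text \<open>The arguments \<open>2 - t\<close> and \<open>t - 1\<close> add up to 1, so at least one
  of them is positive.\<close>

lemma smooth_step_denominator_pos: "0 < flat_exp 0 (2 - t) + flat_exp 0 (t - 1)"
proof (cases "t < 2")
  case True
  then show ?thesis
    by (intro add_pos_nonneg) (auto simp: flat_exp_nonneg flat_exp_pos_iff)
next
  case False
  then show ?thesis
    by (intro add_nonneg_pos) (auto simp: flat_exp_nonneg flat_exp_pos_iff)
qed

lemma smooth_step_eq_1: "t \<le> 1 \<Longrightarrow> smooth_step t = 1"
  by (simp add: smooth_step_def flat_exp_def)

lemma smooth_step_eq_0: "2 \<le> t \<Longrightarrow> smooth_step t = 0"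
  by (simp add: smooth_step_def flat_exp_def)

text \<open>In the slice only \<open>n\<close> coordinates vary, so a basic product neighbourhood
  contains a cube. Cubes fit bump functions that are products of one-variable cutoffs.\<close>

lemma openin_Euclidean_contains_box:
  assumes "openin (Euclidean_space n) D" "a \<in> D"
  obtains d where "d > 0"
    "\<And>x. \<forall>i\<ge>n. x i = 0 \<Longrightarrow> \<forall>i<n. \<bar>x i - a i\<bar> \<le> d \<Longrightarrow> x \<in> D"
proof -
  obtain T where T: "open T" "D = {x. \<forall>i\<ge>n. x i = 0} \<inter> T"
    using assms(1) by (auto simp: Euclidean_space_eq_top_of_set openin_open)
  obtain X where X: "a \<in> Pi\<^sub>E UNIV X" "\<And>i. open (X i)" "Pi\<^sub>E UNIV X \<subseteq> T"
    using product_topology_open_contains_basis[of "\<lambda>i. euclideanreal" UNIV T a] assms(2) T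
    by (auto simp: open_fun_def)
  have "\<forall>i. \<exists>e>0. cball (a i) e \<subseteq> X i"
    using X(1,2) by (auto simp: open_contains_cball PiE_iff)
  then obtain e where e: "\<And>i. e i > 0" "\<And>i. cball (a i) (e i) \<subseteq> X i"
    by metis
  \<comment> \<open>The element 1 keeps the minimum meaningful for \<open>n = 0\<close>.\<close>
  define d where "d = Min (insert 1 (e ` {..<n}))"
  show ?thesis
  proof
    show "d > 0" using e(1) by (simp add: d_def)
    fix x :: "nat \<Rightarrow> real"
    assume x: "\<forall>i\<ge>n. x i = 0" "\<forall>i<n. \<bar>x i - a i\<bar> \<le> d"
    have "x i \<in> X i" for i
    proof (cases "i < n")
      case True
      then have "d \<le> e i" by (auto simp: d_def)
      then have "x i \<in> cball (a i) (e i)"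
        using x(2)[rule_format, OF True] by (simp add: dist_real_def abs_minus_commute)
      then show ?thesis using e(2) by blast
    next
      case False
      then have "x i = a i" using x(1) assms(2) T(2) by auto
      then show ?thesis using X(1) by (auto simp: PiE_iff)
    qed
    then show "x \<in> D" using X(3) T(2) x(1) by auto
  qed
qed

context smooth_mfd
begin

lemma smooth_fun_smooth_step:
  assumes "openin (man_top M) U" "smooth_fun M U f"
  shows "smooth_fun M U (\<lambda>p. smooth_step (f p))"
  unfolding smooth_step_def
  using smooth_step_denominator_pos
  by (intro smooth_fun_divide smooth_fun_add smooth_fun_flat_exp smooth_fun_diff
      smooth_fun_const assms) (simp add: less_imp_neq[symmetric])

text \<open>A product of cutoffs supported on a compact cube \<open>K\<close> in a chart. By the
  Hausdorff property \<open>K\<close> is closed in the whole manifold, so the extension by 0 is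
  smooth: it vanishes on the open complement of \<open>K\<close>, which contains everything outside
  the chart.\<close>

lemma bump_function:
  assumes U: "openin (man_top M) U" and p: "p \<in> U"
  obtains W K f where "openin (man_top M) W" "p \<in> W" "W \<subseteq> U" "closedin (man_top M) K" "K \<subseteq> U"
    "smooth_fun M (topspace (man_top M)) f" "\<And>q. q \<in> W \<Longrightarrow> f q = 1" "\<And>q. q \<notin> K \<Longrightarrow> f q = 0"
proof -
  let ?n = "man_dim M"
  obtain c where c: "c \<in> man_atlas M" "p \<in> fst c"
    using chart_exists U p openin_subset by blast
  define a where "a = snd c p"
  have "openin (Euclidean_space ?n) (snd c ` (U \<inter> fst c))" "a \<in> snd c ` (U \<inter> fst c)"
    using openin_chart_image[OF U c(1)] p c(2) by (auto simp: a_def)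
  then obtain d0 where d0: "d0 > 0" "\<And>x. \<forall>i\<ge>?n. x i = 0 \<Longrightarrow>
      \<forall>i<?n. \<bar>x i - a i\<bar> \<le> d0 \<Longrightarrow> x \<in> snd c ` (U \<inter> fst c)"
    by (rule openin_Euclidean_contains_box) (rule that, assumption, blast)
  define d where "d = d0 / 2"
  have d: "d > 0" "d0 = 2 * d" using d0(1) by (auto simp: d_def)
  \<comment> \<open>Squares keep \<open>r\<close> smooth. The thresholds match those of
    \<open>smooth_step\<close>: \<open>r < 1\<close> means distance below \<open>d\<close>, while
    distance above \<open>d0 = 2 * d\<close> makes \<open>r\<close> larger than 4, hence at least
    2.\<close>
  define r where "r q i = ((snd c q i - a i) / d) ^ 2" for q i
  have r: "r q i < 1 \<longleftrightarrow> \<bar>snd c q i - a i\<bar> < d" "r q i \<le> 1 \<longleftrightarrow> \<bar>snd c q i - a i\<bar> \<le> d"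
    "\<bar>snd c q i - a i\<bar> > d0 \<Longrightarrow> r q i \<ge> 2" for q i
  proof -
    let ?t = "\<bar>(snd c q i - a i) / d\<bar>"
    have rt: "r q i = ?t ^ 2" by (simp only: r_def power2_abs)
    have t: "?t = \<bar>snd c q i - a i\<bar> / d" using d by simp
    have "r q i < 1 \<longleftrightarrow> ?t < 1" "r q i \<le> 1 \<longleftrightarrow> ?t \<le> 1"
      unfolding r_def by (rule abs_square_less_1 abs_square_le_1)+
    then show "r q i < 1 \<longleftrightarrow> \<bar>snd c q i - a i\<bar> < d" "r q i \<le> 1 \<longleftrightarrow> \<bar>snd c q i - a i\<bar> \<le> d"
      using d(1) unfolding t by simp_all
    show "r q i \<ge> 2" if "\<bar>snd c q i - a i\<bar> > d0"
    proof -
      have "2 \<le> ?t" using that d unfolding t by (simp add: divide_simps)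
      then have "2\<^sup>2 \<le> ?t\<^sup>2" by (intro power_mono) auto
      then show ?thesis unfolding rt by simp
    qed
  qed
  have smooth_r: "smooth_fun M (fst c) (\<lambda>q. r q i)" if "i < ?n" for i
    unfolding r_def power2_eq_square using d(1) that
    by (intro smooth_fun_mult smooth_fun_divide smooth_fun_diff smooth_fun_const
        smooth_fun_coordinate openin_chart_domain c) auto
  define f where "f q = (if q \<in> fst c then \<Prod>i<?n. smooth_step (r q i) else 0)" for q
  \<comment> \<open>The open cube \<open>r < 1\<close>, encoded as the set where one smooth function
    does not vanish, so that its openness is already known.\<close>
  define W where "W = {q \<in> fst c. (\<Prod>i<?n. flat_exp 0 (1 - r q i)) \<noteq> 0}"
  define K where "K = {q \<in> fst c. \<forall>i<?n. \<bar>snd c q i - a i\<bar> \<le> d0}"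
  have flat0: "flat_exp 0 x = 0 \<longleftrightarrow> \<not> 0 < x" for x
    by (simp add: flat_exp_def)
  have W_eq: "W = {q \<in> fst c. \<forall>i<?n. r q i < 1}"
    by (auto simp: W_def flat0)
  have chart0: "snd c q i = 0" if "q \<in> fst c" "i \<ge> ?n" for q i
    using openin_subset[OF openin_chart_range[OF c(1)]] that
    by (auto simp: Euclidean_space_eq_top_of_set)
  have KU: "K \<subseteq> U"
  proof
    fix q assume q: "q \<in> K"
    then have "snd c q \<in> snd c ` (U \<inter> fst c)"
      using chart0 by (intro d0(2)) (auto simp: K_def)
    then show "q \<in> U"
      using inj_on_chart[OF c(1)] q by (auto simp: K_def inj_on_def)
  qed
  have f0: "f q = 0" if "q \<notin> K" for q
    using that r(3)[of q] by (force simp: f_def K_def intro: smooth_step_eq_0)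
  \<comment> \<open>With factor \<open>{0}\<close> from \<open>man_dim M\<close> on, the cube is a
    product of compact sets over all indices, and Tychonoff's theorem applies.\<close>
  have "snd c ` K = Pi\<^sub>E UNIV (\<lambda>i. if i < ?n then {a i - d0..a i + d0} else {0})" (is "_ = ?box")
  proof
    show "snd c ` K \<subseteq> ?box"
      using chart0 by (force simp: K_def abs_le_iff)
    show "?box \<subseteq> snd c ` K"
    proof
      fix x assume x: "x \<in> ?box"
      then have x_mem: "x i \<in> (if i < ?n then {a i - d0..a i + d0} else {0})" for i
        by (simp add: PiE_iff)
      have x': "\<forall>i\<ge>?n. x i = 0" "\<forall>i<?n. \<bar>x i - a i\<bar> \<le> d0"
      proof safe
        show "x i = 0" if "i \<ge> ?n" for i using x_mem[of i] that by simp
        show "\<bar>x i - a i\<bar> \<le> d0" if "i < ?n" for i using x_mem[of i] that by (simp, linarith)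
      qed
      then have "x \<in> snd c ` (U \<inter> fst c)"
        by (rule d0(2))
      then show "x \<in> snd c ` K" using x'(2) by (auto simp: K_def)
    qed
  qed
  then have "compactin (product_topology (\<lambda>i. euclideanreal) UNIV) (snd c ` K)"
    by (simp add: compactin_PiE)
  then have "compactin (subtopology (Euclidean_space ?n) (snd c ` fst c)) (snd c ` K)"
    using chart0 unfolding Euclidean_space_def
    by (auto simp: compactin_subtopology K_def)
  then have "compactin (subtopology (man_top M) (fst c)) K"
    using homeomorphic_map_compactness[OF homeomorphic_map_chart[OF c(1)], of K]
      topspace_chart_domain[OF c(1)] by (auto simp: K_def)
  then have "compactin (man_top M) K"
    by (simp add: compactin_subtopology)
  moreover have "Hausdorff_space (man_top M)"
    using smooth_manifold by (simp add: smooth_manifold_def)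
  ultimately have K: "closedin (man_top M) K"
    by (rule compactin_imp_closedin[rotated])
  show thesis
  proof
    show "openin (man_top M) W"
      unfolding W_def
      by (intro openin_smooth_fun_nonzero[OF c(1)] smooth_fun_prod smooth_fun_flat_exp
          smooth_fun_diff smooth_fun_const smooth_r openin_chart_domain c(1)) auto
    show "p \<in> W" using c(2) by (auto simp: W_eq r_def a_def)
    have "W \<subseteq> K"
      using r(1) d by (force simp: W_eq K_def)
    then show "W \<subseteq> U" using KU by blast
    show "closedin (man_top M) K" "K \<subseteq> U" by fact+
    show "f q = 1" if "q \<in> W" for q
      using that by (auto simp: W_eq f_def less_imp_le intro!: prod.neutral smooth_step_eq_1)
    show "f q = 0" if "q \<notin> K" for q by (rule f0[OF that])
    show "smooth_fun M (topspace (man_top M)) f"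
    proof (rule smooth_fun_local)
      fix q assume q: "q \<in> topspace (man_top M)"
      show "\<exists>V. openin (man_top M) V \<and> q \<in> V \<and> V \<subseteq> topspace (man_top M) \<and> smooth_fun M V f"
      proof (cases "q \<in> fst c")
        case True
        have "smooth_fun M (fst c) (\<lambda>q. \<Prod>i<?n. smooth_step (r q i))"
          by (intro smooth_fun_prod smooth_fun_smooth_step smooth_r openin_chart_domain c(1)) auto
        then have "smooth_fun M (fst c) f"
          by (rule smooth_fun_cong[OF openin_chart_domain[OF c(1)], rotated]) (simp add: f_def)
        then show ?thesis
          using True openin_chart_domain[OF c(1)] chart_domain_subset[OF c(1)] by blast
      next
        case False
        have V: "openin (man_top M) (topspace (man_top M) - K)"
          using K by blast
        have "smooth_fun M (topspace (man_top M) - K) f"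
          by (rule smooth_fun_cong[OF V _ smooth_fun_const[of _ 0]]) (auto simp: f0)
        then show ?thesis
          using V False q by (intro exI[of _ "topspace (man_top M) - K"]) (auto simp: K_def)
      qed
    qed
  qed
qed

end

section \<open>Sections and 2-forms\<close>

lemma scaleR_fun_apply: "(r *\<^sub>R f) x = r *\<^sub>R f x"
  by (simp add: scaleR_fun_def)

context smooth_mfd
begin

text \<open>The failure of the Jacobian rule between two charts. It is linear in \<open>X\<close>,
  which exhibits the tangent space as a common kernel and hence as a subspace.\<close>

definition transform_defect :: "'a \<Rightarrow> 'a tangent \<Rightarrow> 'a chart \<Rightarrow> 'a chart \<Rightarrow> nat \<Rightarrow> real" where
  "transform_defect p X c c' i =
     X c' i - (\<Sum>j<man_dim M. partial_deriv j (\<lambda>x. transition c c' x i) (snd c p) * X c j)"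

lemma tangent_space_iff:
  "X \<in> tangent_space M p \<longleftrightarrow>
     (\<forall>c i. c \<notin> charts_at M p \<or> man_dim M \<le> i \<longrightarrow> X c i = 0) \<and>
     (\<forall>c\<in>charts_at M p. \<forall>c'\<in>charts_at M p. \<forall>i<man_dim M. transform_defect p X c c' i = 0)"
  unfolding tangent_space_def topspace_Euclidean_space fun_eq_iff[of _ 0] zero_fun_apply
    transform_defect_def right_minus_eq mem_Collect_eq by blast

lemma transform_defect_linear:
  "transform_defect p 0 c c' i = 0"
  "transform_defect p (X + Y) c c' i = transform_defect p X c c' i + transform_defect p Y c c' i"
  "transform_defect p (r *\<^sub>R X) c c' i = r * transform_defect p X c c' i"
  by (simp_all add: transform_defect_def zero_fun_apply plus_fun_apply scaleR_fun_apply
      algebra_simps sum.distrib sum_distrib_left)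

lemma subspace_tangent_space: "subspace (tangent_space M p)"
  by (rule subspaceI)
    (auto simp: tangent_space_iff transform_defect_linear zero_fun_apply plus_fun_apply
      scaleR_fun_apply)

lemma subspace_cotangent_space: "subspace (cotangent_space M p)"
  by (auto simp: subspace_def cotangent_space_def plus_fun_apply
      zero_fun_apply scaleR_fun_apply algebra_simps)

lemmas tangent_space_closed [simp, intro] =
  subspace_0[OF subspace_tangent_space] subspace_add[OF subspace_tangent_space]
  subspace_diff[OF subspace_tangent_space] subspace_scale[OF subspace_tangent_space]

lemmas cotangent_space_closed [simp, intro] =
  subspace_0[OF subspace_cotangent_space] subspace_add[OF subspace_cotangent_space]
  subspace_diff[OF subspace_cotangent_space] subspace_scale[OF subspace_cotangent_space]

lemma cotangent_add:
  "\<alpha> \<in> cotangent_space M p \<Longrightarrow> X \<in> tangent_space M p \<Longrightarrow> Y \<in> tangent_space M p \<Longrightarrow>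
    \<alpha> (X + Y) = \<alpha> X + \<alpha> Y"
  by (simp add: cotangent_space_def)

lemma cotangent_scaleR:
  "\<alpha> \<in> cotangent_space M p \<Longrightarrow> X \<in> tangent_space M p \<Longrightarrow> \<alpha> (r *\<^sub>R X) = r * \<alpha> X"
  by (simp add: cotangent_space_def)

text \<open>A covector is extended by 0 off the tangent space, so it is linear only on that subspace
  and every partial sum has to be kept inside it.\<close>

lemma cotangent_sum:
  assumes "\<alpha> \<in> cotangent_space M p" "\<And>i. i \<in> I \<Longrightarrow> X i \<in> tangent_space M p"
  shows "\<alpha> (\<Sum>i\<in>I. r i *\<^sub>R X i) = (\<Sum>i\<in>I. r i * \<alpha> (X i))"
  using assms(2)
proof (induction I rule: infinite_finite_induct)
  case (insert i I)
  have "r i *\<^sub>R X i \<in> tangent_space M p" "(\<Sum>i\<in>I. r i *\<^sub>R X i) \<in> tangent_space M p"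
    using insert.prems by (auto intro: subspace_sum[OF subspace_tangent_space])
  then have "\<alpha> (r i *\<^sub>R X i + (\<Sum>i\<in>I. r i *\<^sub>R X i)) = \<alpha> (r i *\<^sub>R X i) + \<alpha> (\<Sum>i\<in>I. r i *\<^sub>R X i)"
    by (rule cotangent_add[OF assms(1)])
  moreover have "\<alpha> (r i *\<^sub>R X i) = r i * \<alpha> (X i)"
    using assms(1) insert.prems by (intro cotangent_scaleR) auto
  moreover have "\<alpha> (\<Sum>i\<in>I. r i *\<^sub>R X i) = (\<Sum>i\<in>I. r i * \<alpha> (X i))"
    using insert by auto
  ultimately show ?case
    unfolding sum.insert[OF insert.hyps] by argo
qed (use cotangent_scaleR[OF assms(1), of 0 0] in \<open>simp_all\<close>)

section \<open>The Euclidean product of a chart\<close>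

definition chart_inner :: "'a chart \<Rightarrow> 'a tangent \<Rightarrow> 'a tangent \<Rightarrow> real" where
  "chart_inner c X Y = (\<Sum>i<man_dim M. X c i * Y c i)"

lemma chart_inner_commute: "chart_inner c X Y = chart_inner c Y X"
  by (simp add: chart_inner_def mult.commute)

lemma linear_chart_inner: "linear (chart_inner c X)"
  by (rule linearI)
    (simp_all add: chart_inner_def plus_fun_apply scaleR_fun_apply distrib_left sum.distrib
      sum_distrib_left mult.left_commute)

lemmas chart_inner_linear =
  linear_0[OF linear_chart_inner] linear_add[OF linear_chart_inner]
  linear_diff[OF linear_chart_inner] linear_scale[OF linear_chart_inner]
  linear_sum[OF linear_chart_inner]

text \<open>The Jacobian rule recovers the coordinates in all charts from those in \<open>c\<close>.
  Definiteness thus holds on tangent vectors, not on arbitrary families of coordinate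
  vectors.\<close>

lemma chart_inner_self_eq_0:
  assumes c: "c \<in> man_atlas M" "p \<in> fst c" and X: "X \<in> tangent_space M p"
    and "chart_inner c X X = 0"
  shows "X = 0"
proof -
  have Xc: "X c i = 0" if "i < man_dim M" for i
    using assms(4) that by (simp add: chart_inner_def sum_nonneg_eq_0_iff)
  have "X c' i = 0" for c' i
  proof (cases "c' \<in> charts_at M p \<and> i < man_dim M")
    case True
    then have "X c' i = (\<Sum>j<man_dim M. partial_deriv j (\<lambda>x. transition c c' x i) (snd c p) * X c j)"
      using X c unfolding tangent_space_def charts_at_def by blast
    then show ?thesis by (simp add: Xc)
  next
    case False
    then show ?thesis
      using X unfolding tangent_space_iff by (meson not_le)
  qed
  then show ?thesis by (simp add: fun_eq_iff zero_fun_apply)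
qed

text \<open>Orthogonal vectors with nonzero squares are independent; \<open>orth\<close> expresses
  both conditions at once. The ambient vector space has infinite dimension, and the finite
  \<open>F\<close> ensures that a basis of \<open>R\<close> is finite, so that cardinalities can be
  compared.\<close>

lemma card_orthogonal_le_dim:
  assumes c: "c \<in> man_atlas M" "p \<in> fst c"
    and R: "R \<subseteq> span F" "finite F"
    and X: "\<And>i. i < m \<Longrightarrow> X i \<in> R"
    and orth: "\<And>i j. i < m \<Longrightarrow> j < m \<Longrightarrow> chart_inner c (X i) (X j) \<noteq> 0 \<longleftrightarrow> i = j"
  shows "m \<le> dim R"
proof -
  have inj: "inj_on X {..<m}"
    using orth by (metis inj_onI lessThan_iff)
  have "independent (X ` {..<m})"
  proof (rule independent_if_scalars_zero)
    fix u w assume 0: "(\<Sum>v\<in>X ` {..<m}. u v *\<^sub>R v) = 0" and "w \<in> X ` {..<m}"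
    then obtain j where j: "j < m" "w = X j" by auto
    have "0 = chart_inner c (X j) (\<Sum>i<m. u (X i) *\<^sub>R X i)"
      using 0 by (simp add: sum.reindex[OF inj] chart_inner_linear)
    also have "\<dots> = (\<Sum>i<m. if i = j then u (X j) * chart_inner c (X j) (X j) else 0)"
      unfolding chart_inner_linear using orth j(1) by (intro sum.cong) auto
    also have "\<dots> = u (X j) * chart_inner c (X j) (X j)"
      using j(1) by simp
    finally show "u w = 0"
      using orth[of j j] j by simp
  qed simp
  moreover obtain B where B: "B \<subseteq> R" "independent B" "R \<subseteq> span B" "card B = dim R"
    by (rule basis_exists)
  moreover have "finite B"
    using independent_span_bound[OF R(2) B(2)] B(1) R(1) by blast
  ultimately have "card (X ` {..<m}) \<le> card B"
    using X independent_span_bound[of B "X ` {..<m}"] by blast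
  then show ?thesis
    using B(4) by (simp add: card_image[OF inj])
qed

lemma smooth_vector_field_subset:
  "smooth_vector_field M U X \<Longrightarrow> V \<subseteq> U \<Longrightarrow> smooth_vector_field M V X"
  unfolding smooth_vector_field_def by (meson Int_mono order_refl smooth_fun_subset subsetD)

lemma smooth_1form_subset: "smooth_1form M U \<alpha> \<Longrightarrow> V \<subseteq> U \<Longrightarrow> smooth_1form M V \<alpha>"
  unfolding smooth_1form_def by (meson order_trans subsetD)

lemma smooth_fun_1form:
  assumes "smooth_1form M U \<alpha>" "openin (man_top M) U" "smooth_vector_field M U X"
  shows "smooth_fun M U (\<lambda>p. \<alpha> p (X p))"
  using assms unfolding smooth_1form_def by blast

lemma smooth_fun_chart_inner:
  assumes c: "c \<in> man_atlas M" and V: "openin (man_top M) V" "V \<subseteq> fst c"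
    and "smooth_vector_field M V X" "smooth_vector_field M V Y"
  shows "smooth_fun M V (\<lambda>q. chart_inner c (X q) (Y q))"
proof -
  have "smooth_fun M V (\<lambda>q. X q c i)" "smooth_fun M V (\<lambda>q. Y q c i)" if "i < man_dim M" for i
    using assms that unfolding smooth_vector_field_def by (metis Int_absorb2)+
  then show ?thesis
    unfolding chart_inner_def by (intro smooth_fun_sum smooth_fun_mult V(1)) auto
qed

section \<open>Smooth sections of the double bundle\<close>

definition smooth_section :: "'a set \<Rightarrow> ('a \<Rightarrow> 'a tangent \<times> 'a cotangent) \<Rightarrow> bool" where
  "smooth_section U s \<longleftrightarrow>
     smooth_vector_field M U (\<lambda>q. fst (s q)) \<and> smooth_1form M U (\<lambda>q. snd (s q))"

lemma smooth_section_subset: "smooth_section U s \<Longrightarrow> V \<subseteq> U \<Longrightarrow> smooth_section V s"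
  unfolding smooth_section_def by (blast intro: smooth_vector_field_subset smooth_1form_subset)

lemma smooth_section_add_scaleR:
  assumes U: "openin (man_top M) U" and s: "smooth_section U s" and t: "smooth_section U t"
    and f: "smooth_fun M U f"
  shows "smooth_section U (\<lambda>q. s q + f q *\<^sub>R t q)"
  unfolding smooth_section_def
proof
  show "smooth_vector_field M U (\<lambda>q. fst (s q + f q *\<^sub>R t q))"
    unfolding smooth_vector_field_def
  proof safe
    fix q assume "q \<in> U"
    then show "fst (s q + f q *\<^sub>R t q) \<in> tangent_space M q"
      using s t by (auto simp: smooth_section_def smooth_vector_field_def)
  next
    fix A \<phi> i assume c: "(A, \<phi>) \<in> man_atlas M" "i < man_dim M"
    have o: "openin (man_top M) (U \<inter> A)"
      using U openin_chart_domain[OF c(1)] by auto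
    have "smooth_fun M (U \<inter> A) (\<lambda>q. fst (s q) (A, \<phi>) i)"
      "smooth_fun M (U \<inter> A) (\<lambda>q. fst (t q) (A, \<phi>) i)"
      using s t c by (force simp: smooth_section_def smooth_vector_field_def)+
    then have "smooth_fun M (U \<inter> A) (\<lambda>q. fst (s q) (A, \<phi>) i + f q * fst (t q) (A, \<phi>) i)"
      using smooth_fun_subset[OF f, of "U \<inter> A"] by (intro smooth_fun_add smooth_fun_mult o) auto
    then show "smooth_fun M (U \<inter> fst (A, \<phi>)) (\<lambda>q. fst (s q + f q *\<^sub>R t q) (A, \<phi>) i)"
      by (simp add: plus_fun_apply scaleR_fun_apply)
  qed
  show "smooth_1form M U (\<lambda>q. snd (s q + f q *\<^sub>R t q))"
    unfolding smooth_1form_def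
  proof safe
    fix q assume "q \<in> U"
    then show "snd (s q + f q *\<^sub>R t q) \<in> cotangent_space M q"
      using s t by (auto simp: smooth_section_def smooth_1form_def)
  next
    fix V X assume V: "openin (man_top M) V" "V \<subseteq> U" "smooth_vector_field M V X"
    have "smooth_fun M V (\<lambda>q. snd (s q) (X q) + f q * snd (t q) (X q))"
      using s t V f by (intro smooth_fun_add smooth_fun_mult)
        (auto simp: smooth_section_def smooth_1form_def intro: smooth_fun_subset)
    then show "smooth_fun M V (\<lambda>q. snd (s q + f q *\<^sub>R t q) (X q))"
      by (simp add: plus_fun_apply scaleR_fun_apply)
  qed
qed

lemma smooth_section_add_sum:
  fixes j :: nat
  assumes "openin (man_top M) U" "smooth_section U s"
    and "\<And>i. i < j \<Longrightarrow> smooth_section U (t i)" "\<And>i. i < j \<Longrightarrow> smooth_fun M U (f i)"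
  shows "smooth_section U (\<lambda>q. s q + (\<Sum>i<j. f i q *\<^sub>R t i q))"
  using assms(3,4)
proof (induction j)
  case (Suc j)
  then have "smooth_section U (\<lambda>q. s q + (\<Sum>i<j. f i q *\<^sub>R t i q) + f j q *\<^sub>R t j q)"
    by (intro smooth_section_add_scaleR assms(1)) auto
  then show ?case by (simp add: add.assoc)
qed (use assms(2) in simp)

section \<open>Smooth 2-forms on open sets\<close>

definition alternating_at :: "'a \<Rightarrow> ('a tangent \<Rightarrow> 'a cotangent) \<Rightarrow> bool" where
  "alternating_at p b \<longleftrightarrow>
        (\<forall>X\<in>tangent_space M p. b X \<in> cotangent_space M p) \<and>
        (\<forall>X\<in>tangent_space M p. \<forall>Y\<in>tangent_space M p. b (X + Y) = b X + b Y) \<and>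
        (\<forall>r. \<forall>X\<in>tangent_space M p. b (r *\<^sub>R X) = r *\<^sub>R b X) \<and>
        (\<forall>X\<in>tangent_space M p. b X X = 0)"

lemma alternating_at_lincomb:
  assumes b: "alternating_at p b" and b': "alternating_at p b'"
  shows "alternating_at p (r *\<^sub>R b + s *\<^sub>R b')"
proof -
  have eq: "(r *\<^sub>R b + s *\<^sub>R b') X = r *\<^sub>R b X + s *\<^sub>R b' X" for X
    by (simp only: plus_fun_apply scaleR_fun_apply)
  show ?thesis
    unfolding alternating_at_def eq
  proof (intro conjI ballI allI)
    fix X Y t assume X: "X \<in> tangent_space M p" and Y: "Y \<in> tangent_space M p"
    show "r *\<^sub>R b X + s *\<^sub>R b' X \<in> cotangent_space M p"
      using b b' X unfolding alternating_at_def by blast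
    have "b (X + Y) = b X + b Y" "b' (X + Y) = b' X + b' Y"
      using b b' X Y unfolding alternating_at_def by blast+
    then show "r *\<^sub>R b (X + Y) + s *\<^sub>R b' (X + Y) = r *\<^sub>R b X + s *\<^sub>R b' X + (r *\<^sub>R b Y + s *\<^sub>R b' Y)"
      by (simp only: scaleR_add_right ac_simps)
    have "b (t *\<^sub>R X) = t *\<^sub>R b X" "b' (t *\<^sub>R X) = t *\<^sub>R b' X"
      using b b' X unfolding alternating_at_def by blast+
    then show "r *\<^sub>R b (t *\<^sub>R X) + s *\<^sub>R b' (t *\<^sub>R X) = t *\<^sub>R (r *\<^sub>R b X + s *\<^sub>R b' X)"
      by (simp only: scaleR_add_right scaleR_left_commute)
    have "b X X = 0" "b' X X = 0"
      using b b' X unfolding alternating_at_def by blast+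
    then show "(r *\<^sub>R b X + s *\<^sub>R b' X) X = 0"
      by (simp add: plus_fun_apply scaleR_fun_apply)
  qed
qed

definition smooth_2form_on :: "'a set \<Rightarrow> ('a \<Rightarrow> 'a tangent \<Rightarrow> 'a cotangent) \<Rightarrow> bool" where
  "smooth_2form_on U B \<longleftrightarrow> (\<forall>p\<in>U. alternating_at p (B p)) \<and>
     (\<forall>V X Y. openin (man_top M) V \<and> V \<subseteq> U \<and> smooth_vector_field M V X \<and>
        smooth_vector_field M V Y \<longrightarrow> smooth_fun M V (\<lambda>p. B p (X p) (Y p)))"

lemma smooth_2form_iff: "smooth_2form M B \<longleftrightarrow> smooth_2form_on (topspace (man_top M)) B"
proof -
  have "openin (man_top M) V \<and> V \<subseteq> topspace (man_top M) \<and> P \<longleftrightarrow> openin (man_top M) V \<and> P" for V P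
    by (auto dest: openin_subset)
  then show ?thesis
    unfolding smooth_2form_def smooth_2form_on_def alternating_at_def by (simp only:)
qed

lemma smooth_2form_onI:
  assumes "\<And>p. p \<in> U \<Longrightarrow> alternating_at p (B p)"
    and "\<And>V X Y. openin (man_top M) V \<Longrightarrow> V \<subseteq> U \<Longrightarrow> smooth_vector_field M V X \<Longrightarrow>
      smooth_vector_field M V Y \<Longrightarrow> smooth_fun M V (\<lambda>p. B p (X p) (Y p))"
  shows "smooth_2form_on U B"
  using assms unfolding smooth_2form_on_def by blast

lemma smooth_2form_onD:
  assumes "smooth_2form_on U B"
  shows "p \<in> U \<Longrightarrow> alternating_at p (B p)"
    and "openin (man_top M) V \<Longrightarrow> V \<subseteq> U \<Longrightarrow> smooth_vector_field M V X \<Longrightarrow>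
      smooth_vector_field M V Y \<Longrightarrow> smooth_fun M V (\<lambda>p. B p (X p) (Y p))"
  using assms unfolding smooth_2form_on_def by blast+

lemma smooth_2form_on_subset:
  assumes "smooth_2form_on U B" "V \<subseteq> U"
  shows "smooth_2form_on V B"
  using smooth_2form_onD[OF assms(1)] assms(2) by (intro smooth_2form_onI) auto

lemma smooth_2form_on_zero: "smooth_2form_on U (\<lambda>p. 0)"
  by (rule smooth_2form_onI) (auto simp: alternating_at_def zero_fun_apply smooth_fun_const)

lemma smooth_2form_on_lincomb:
  assumes B: "smooth_2form_on U B" "smooth_2form_on U B'"
    and fg: "smooth_fun M U f" "smooth_fun M U g"
  shows "smooth_2form_on U (\<lambda>p. f p *\<^sub>R B p + g p *\<^sub>R B' p)"
proof (rule smooth_2form_onI)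
  fix p assume "p \<in> U"
  then have "alternating_at p (B p)" "alternating_at p (B' p)"
    by (auto intro: B[THEN smooth_2form_onD(1)])
  then show "alternating_at p (f p *\<^sub>R B p + g p *\<^sub>R B' p)"
    by (rule alternating_at_lincomb)
next
  fix V X Y assume V: "openin (man_top M) V" "V \<subseteq> U" "smooth_vector_field M V X"
    "smooth_vector_field M V Y"
  have "smooth_fun M V (\<lambda>p. f p * B p (X p) (Y p) + g p * B' p (X p) (Y p))"
    using V fg by (intro smooth_fun_add smooth_fun_mult B[THEN smooth_2form_onD(2)])
      (auto intro: smooth_fun_subset)
  then show "smooth_fun M V (\<lambda>p. (f p *\<^sub>R B p + g p *\<^sub>R B' p) (X p) (Y p))"
    by (simp add: plus_fun_apply scaleR_fun_apply)
qed

lemma smooth_2form_on_cong: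
  assumes "\<And>p. p \<in> U \<Longrightarrow> B p = B' p" "smooth_2form_on U B"
  shows "smooth_2form_on U B'"
proof (rule smooth_2form_onI)
  show "alternating_at p (B' p)" if "p \<in> U" for p
    using smooth_2form_onD(1)[OF assms(2) that] assms(1)[OF that] by simp
  fix V X Y assume V: "openin (man_top M) V" "V \<subseteq> U" "smooth_vector_field M V X"
    "smooth_vector_field M V Y"
  then have "smooth_fun M V (\<lambda>p. B p (X p) (Y p))"
    by (rule smooth_2form_onD(2)[OF assms(2)])
  then show "smooth_fun M V (\<lambda>p. B' p (X p) (Y p))"
    by (rule smooth_fun_cong[OF V(1), rotated]) (use V(2) assms(1) in auto)
qed

lemma smooth_2form_on_local:
  assumes "\<And>p. p \<in> U \<Longrightarrow> \<exists>V. openin (man_top M) V \<and> p \<in> V \<and> smooth_2form_on V B"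
  shows "smooth_2form_on U B"
proof (rule smooth_2form_onI)
  show "alternating_at p (B p)" if "p \<in> U" for p
    using assms[OF that] smooth_2form_onD(1) by blast
  fix V X Y assume V: "openin (man_top M) V" "V \<subseteq> U" "smooth_vector_field M V X"
    "smooth_vector_field M V Y"
  show "smooth_fun M V (\<lambda>p. B p (X p) (Y p))"
  proof (rule smooth_fun_local)
    fix p assume p: "p \<in> V"
    then obtain W where W: "openin (man_top M) W" "p \<in> W" "smooth_2form_on W B"
      using assms V(2) by blast
    have o: "openin (man_top M) (V \<inter> W)" using V(1) W(1) by blast
    moreover have "smooth_vector_field M (V \<inter> W) X" "smooth_vector_field M (V \<inter> W) Y"
      using V by (auto intro: smooth_vector_field_subset)
    ultimately have "smooth_fun M (V \<inter> W) (\<lambda>p. B p (X p) (Y p))"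
      by (intro smooth_2form_onD(2)[OF W(3)]) auto
    then show "\<exists>U. openin (man_top M) U \<and> p \<in> U \<and> U \<subseteq> V \<and> smooth_fun M U (\<lambda>p. B p (X p) (Y p))"
      using o p W(2) by blast
  qed
qed

end

section \<open>Gluing local 2-forms\<close>

context smooth_mfd
begin

text \<open>The partition of unity \<open>f\<^sub>n * (\<Prod>k<n. 1 - f\<^sub>k)\<close> built from countably many bump functions \<open>f\<^sub>n\<close> is
  locally finite as soon as the interiors of the sets where \<open>f\<^sub>n = 1\<close> cover the manifold. The
  Lindelof property suffices, paracompactness is not needed.\<close>

lemma glue_2forms:
  assumes loc: "\<And>p. p \<in> topspace (man_top M) \<Longrightarrow>
      \<exists>U B. openin (man_top M) U \<and> p \<in> U \<and> smooth_2form_on U B \<and> (\<forall>q\<in>U. \<Phi> q (B q))"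
    and affine: "\<And>q b b' t. \<Phi> q b \<Longrightarrow> \<Phi> q b' \<Longrightarrow> \<Phi> q ((1 - t) *\<^sub>R b + t *\<^sub>R b')"
  shows "\<exists>B. smooth_2form M B \<and> (\<forall>q\<in>topspace (man_top M). \<Phi> q (B q))"
proof -
  let ?T = "topspace (man_top M)"
  \<comment> \<open>All data attached to one bump function are packed together, so that a single
    countable choice selects them simultaneously.\<close>
  define good where "good W U K f \<omega> \<longleftrightarrow> openin (man_top M) W \<and> openin (man_top M) U \<and>
      closedin (man_top M) K \<and> W \<subseteq> U \<and> K \<subseteq> U \<and> smooth_fun M ?T f \<and> (\<forall>q\<in>W. f q = 1) \<and>
      (\<forall>q. q \<notin> K \<longrightarrow> f q = 0) \<and> smooth_2form_on U \<omega> \<and> (\<forall>q\<in>U. \<Phi> q (\<omega> q))"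
    for W U K and f :: "'a \<Rightarrow> real" and \<omega>
  have ex_good: "\<exists>W. p \<in> W \<and> (\<exists>U K f \<omega>. good W U K f \<omega>)" if p: "p \<in> ?T" for p
  proof -
    obtain U \<omega> where U: "openin (man_top M) U" "p \<in> U" "smooth_2form_on U \<omega>" "\<forall>q\<in>U. \<Phi> q (\<omega> q)"
      using loc[OF p] by blast
    obtain W K f where "openin (man_top M) W" "p \<in> W" "W \<subseteq> U" "closedin (man_top M) K" "K \<subseteq> U"
      "smooth_fun M ?T f" "\<And>q. q \<in> W \<Longrightarrow> f q = 1" "\<And>q. q \<notin> K \<Longrightarrow> f q = 0"
      using bump_function[OF U(1,2)] by metis
    then have "good W U K f \<omega>"
      using U unfolding good_def by blast
    with \<open>p \<in> W\<close> show ?thesis by blast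
  qed
  define \<W> where "\<W> = {W. \<exists>U K f \<omega>. good W U K f \<omega>}"
  have Lindelof: "Lindelof_space (man_top M)"
    using smooth_manifold by (intro second_countable_imp_Lindelof_space) (simp add: smooth_manifold_def)
  have \<W>_open: "openin (man_top M) W" if W: "W \<in> \<W>" for W
  proof -
    obtain U K f \<omega> where "good W U K f \<omega>" using W unfolding \<W>_def by blast
    then show ?thesis by (simp add: good_def)
  qed
  have "\<Union>\<W> = ?T"
  proof
    show "\<Union>\<W> \<subseteq> ?T" using openin_subset[OF \<W>_open] by (intro Union_least)
    show "?T \<subseteq> \<Union>\<W>"
    proof
      fix p assume "p \<in> ?T"
      from ex_good[OF this] obtain W where "p \<in> W \<and> (\<exists>U K f \<omega>. good W U K f \<omega>)" ..
      then show "p \<in> \<Union>\<W>" by (intro UnionI[of W]) (simp_all only: \<W>_def mem_Collect_eq)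
    qed
  qed
  with \<W>_open have "\<exists>\<V>. countable \<V> \<and> \<V> \<subseteq> \<W> \<and> \<Union>\<V> = ?T"
    by (intro Lindelof_spaceD[OF Lindelof])
  then obtain \<V> where \<V>: "countable \<V>" "\<V> \<subseteq> \<W>" "\<Union>\<V> = ?T"
    by (elim exE conjE) (rule that)
  \<comment> \<open>Adding the empty set makes the countable cover nonempty even for an empty
    manifold, so that it can be enumerated by all natural numbers.\<close>
  have "good {} {} {} (\<lambda>q. 0) (\<lambda>q. 0)"
    by (simp add: good_def smooth_fun_const smooth_2form_on_zero)
  then have "{} \<in> \<W>"
    unfolding \<W>_def by blast
  define W where "W = from_nat_into (insert {} \<V>)"
  have "range W = insert {} \<V>"
    unfolding W_def using \<V>(1) by (intro range_from_nat_into) auto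
  then have "W n \<in> insert {} \<V>" for n
    by (metis rangeI)
  then have "\<forall>n. W n \<in> \<W>"
    using \<V>(2) \<open>{} \<in> \<W>\<close> by (metis insertE subsetD)
  then obtain U K f \<omega> where good: "\<And>n. good (W n) (U n) (K n) (f n) (\<omega> n)"
    unfolding \<W>_def mem_Collect_eq choice_iff by (elim exE) (rule that, erule spec)
  have W_cover: "(\<Union>n. W n) = ?T"
    unfolding \<open>range W = insert {} \<V>\<close> using \<V>(3) by simp
  have UW: "openin (man_top M) (U n)" "openin (man_top M) (W n)" "closedin (man_top M) (K n)"
    "W n \<subseteq> U n" "K n \<subseteq> U n" "smooth_fun M ?T (f n)" "smooth_2form_on (U n) (\<omega> n)"
    "\<And>q. q \<in> W n \<Longrightarrow> f n q = 1" "\<And>q. q \<notin> K n \<Longrightarrow> f n q = 0" "\<And>q. q \<in> U n \<Longrightarrow> \<Phi> q (\<omega> n q)" for n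
    using good[of n] by (simp_all add: good_def)
  \<comment> \<open>\<open>R n\<close> is the weight left after the first \<open>n\<close> bumps:
    the weights \<open>f k * R k\<close> for \<open>k < n\<close> together with \<open>R n\<close>
    add up to 1.\<close>
  define R where "R n q = (\<Prod>k<n. 1 - f k q)" for n q
  define S where "S n q = (\<Sum>k<n. (f k q * R k q) *\<^sub>R \<omega> k q)" for n q
  have S_Suc: "S (Suc n) q = S n q + (f n q * R n q) *\<^sub>R \<omega> n q" for n q
    by (simp add: S_def)
  have smooth_R: "smooth_fun M ?T (R n)" for n
    unfolding R_def by (intro smooth_fun_prod smooth_fun_diff smooth_fun_const UW) auto
  \<comment> \<open>The form \<open>\<omega> n\<close> is controlled only on \<open>U n\<close>, but
    its weight vanishes off \<open>K n\<close>. Since \<open>K n\<close> lies in \<open>U n\<close>,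
    the open sets \<open>U n\<close> and the complement of \<open>K n\<close> cover the
    manifold.\<close>
  have smooth_S: "smooth_2form_on ?T (S n)" for n
  proof (induction n)
    case 0
    show ?case
      by (rule smooth_2form_on_cong[OF _ smooth_2form_on_zero]) (simp add: S_def fun_eq_iff)
  next
    case (Suc n)
    show ?case
    proof (rule smooth_2form_on_local)
      fix p assume p: "p \<in> ?T"
      show "\<exists>V. openin (man_top M) V \<and> p \<in> V \<and> smooth_2form_on V (S (Suc n))"
      proof (cases "p \<in> U n")
        case True
        have sub: "U n \<subseteq> ?T" using UW(1) by (rule openin_subset)
        have "smooth_2form_on (U n) (\<lambda>q. 1 *\<^sub>R S n q + (f n q * R n q) *\<^sub>R \<omega> n q)"
          using Suc.IH sub UW(6) smooth_R
          by (intro smooth_2form_on_lincomb smooth_fun_mult smooth_fun_const UW)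
            (auto intro: smooth_2form_on_subset smooth_fun_subset)
        then have "smooth_2form_on (U n) (S (Suc n))"
          by (rule smooth_2form_on_cong[rotated]) (simp only: S_Suc scaleR_one)
        then show ?thesis using True UW(1) by blast
      next
        case False
        have "smooth_2form_on (?T - K n) (S (Suc n))"
          by (rule smooth_2form_on_cong[OF _ smooth_2form_on_subset[OF Suc.IH]])
            (auto simp: S_Suc UW(9))
        then show ?thesis
          using False p UW(3,5) by (intro exI[of _ "?T - K n"]) blast
      qed
    qed
  qed
  \<comment> \<open>A placeholder \<open>b\<close> carries the remaining weight. Peeling off the
    last bump replaces \<open>b\<close> by a two-point affine combination of \<open>b\<close> and
    \<open>\<omega> n q\<close>, so \<open>b\<close> must be arbitrary in the induction. Off
    \<open>U n\<close> that combination is \<open>b\<close> itself.\<close>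
  have \<Phi>_S: "\<Phi> q (S n q + R n q *\<^sub>R b)" if "\<Phi> q b" for n q b
    using that
  proof (induction n arbitrary: b)
    case 0
    then show ?case by (simp add: S_def R_def)
  next
    case (Suc n)
    have "\<Phi> q ((1 - f n q) *\<^sub>R b + f n q *\<^sub>R \<omega> n q)"
    proof (cases "q \<in> U n")
      case True
      then show ?thesis using Suc.prems UW(10) by (intro affine)
    next
      case False
      then have "f n q = 0" using UW(5,9) by blast
      then show ?thesis using Suc.prems by simp
    qed
    then have "\<Phi> q (S n q + R n q *\<^sub>R ((1 - f n q) *\<^sub>R b + f n q *\<^sub>R \<omega> n q))"
      by (rule Suc.IH)
    moreover have "R n q *\<^sub>R ((1 - f n q) *\<^sub>R b + f n q *\<^sub>R \<omega> n q) =
        (f n q * R n q) *\<^sub>R \<omega> n q + R (Suc n) q *\<^sub>R b"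
      by (simp only: R_def prod.lessThan_Suc scaleR_add_right scaleR_scaleR ac_simps)
    ultimately show ?case
      by (simp only: S_Suc add.assoc)
  qed
  have R_0: "R n q = 0" if "q \<in> W k" "k < n" for q k n
    using that UW(8) by (auto simp: R_def)
  \<comment> \<open>On \<open>W k\<close> the factor \<open>1 - f k\<close> is 0, so all terms after
    the \<open>k\<close>-th vanish.\<close>
  have S_stable: "S n q = S (Suc k) q" if "q \<in> W k" "Suc k \<le> n" for q k n
    using that(2)
  proof (induction n rule: dec_induct)
    case (step n)
    then show ?case using R_0[OF that(1), of n] by (simp only: S_Suc) simp
  qed simp
  \<comment> \<open>The eventual value of \<open>S n q\<close>. The \<open>Suc\<close> includes the
    term of index \<open>k\<close> itself, which may still be nonzero.\<close>
  define B where "B q = S (Suc (LEAST k. q \<in> W k)) q" for q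
  have B_eq: "B q = S (Suc k) q" if "q \<in> W k" for q k
  proof -
    have "q \<in> W (LEAST k. q \<in> W k)" "(LEAST k. q \<in> W k) \<le> k"
      using LeastI[of "\<lambda>k. q \<in> W k", OF that] Least_le[of "\<lambda>k. q \<in> W k", OF that] .
    then show ?thesis
      using S_stable[of q "LEAST k. q \<in> W k" "Suc k"] by (simp add: B_def)
  qed
  have smooth_B: "smooth_2form M B"
    unfolding smooth_2form_iff
  proof (rule smooth_2form_on_local)
    fix p assume "p \<in> ?T"
    then obtain k where k: "p \<in> W k" using W_cover by blast
    have "smooth_2form_on (W k) B"
      by (rule smooth_2form_on_cong[OF B_eq[symmetric]
          smooth_2form_on_subset[OF smooth_S openin_subset[OF UW(2)]]])
    then show "\<exists>V. openin (man_top M) V \<and> p \<in> V \<and> smooth_2form_on V B"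
      using k UW(2) by blast
  qed
  have "\<Phi> q (B q)" if q: "q \<in> ?T" for q
  proof -
    obtain k where k: "q \<in> W k" using q W_cover by blast
    \<comment> \<open>Any admissible value \<open>b q\<close> will do as placeholder, since its
      weight \<open>R (Suc k) q\<close> is 0.\<close>
    obtain V b where "q \<in> V" "\<forall>q\<in>V. \<Phi> q (b q)"
      using loc[OF q] by (elim exE conjE) (rule that)
    then have "\<Phi> q (S (Suc k) q + R (Suc k) q *\<^sub>R b q)" by (intro \<Phi>_S) simp
    then show ?thesis using R_0[OF k, of "Suc k"] B_eq[OF k] by simp
  qed
  with smooth_B show ?thesis
    by (intro exI[of _ B] conjI ballI)
qed

end

section \<open>Regular almost Dirac structures\<close>

lemma pr1_fibre: "pr1 L `` {q} = fst ` (L `` {q})"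
  by (force simp: pr1_def)

context smooth_mfd
begin

text \<open>The remainder \<open>Z\<close> after subtracting all projections is orthogonal to the
  whole family. If it were nonzero, \<open>R\<close> would contain \<open>dim R + 1\<close>
  orthogonal vectors with nonzero squares.\<close>

lemma orthogonal_expansion:
  assumes c: "c \<in> man_atlas M" "q \<in> fst c"
    and R: "subspace R" "R \<subseteq> tangent_space M q" "R \<subseteq> span F" "finite F"
    and X: "\<And>i. i < dim R \<Longrightarrow> X i \<in> R"
    and orth: "\<And>i j. i < dim R \<Longrightarrow> j < dim R \<Longrightarrow> chart_inner c (X i) (X j) \<noteq> 0 \<longleftrightarrow> i = j"
    and Y: "Y \<in> R"
  shows "Y = (\<Sum>i<dim R. (chart_inner c (X i) Y / chart_inner c (X i) (X i)) *\<^sub>R X i)"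
proof (rule ccontr)
  define m where "m = dim R"
  define y where "y i = chart_inner c (X i) Y / chart_inner c (X i) (X i)" for i
  define Z where "Z = Y - (\<Sum>i<m. y i *\<^sub>R X i)"
  assume "\<not> ?thesis"
  then have "Z \<noteq> 0" by (simp only: Z_def m_def y_def right_minus_eq not_False_eq_True)
  have Z: "Z \<in> R"
    unfolding Z_def using R(1) X Y
    by (intro subspace_diff subspace_sum subspace_scale) (auto simp: m_def)
  have ZZ: "chart_inner c Z Z \<noteq> 0"
    using chart_inner_self_eq_0[OF c subsetD[OF R(2) Z]] \<open>Z \<noteq> 0\<close> by metis
  have XZ: "chart_inner c (X j) Z = 0" if j: "j < m" for j
  proof -
    have "(\<Sum>i<m. y i * chart_inner c (X j) (X i)) =
        (\<Sum>i<m. if i = j then y j * chart_inner c (X j) (X j) else 0)"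
      using orth j by (intro sum.cong) (auto simp: m_def)
    also have "\<dots> = chart_inner c (X j) Y"
      using j orth[of j j] by (simp add: y_def m_def)
    finally show ?thesis
      by (simp add: Z_def chart_inner_linear)
  qed
  then have ZX: "chart_inner c Z (X j) = 0" if "j < m" for j
    using that by (simp add: chart_inner_commute)
  have "Suc m \<le> dim R"
  proof (rule card_orthogonal_le_dim[OF c R(3,4), where X = "X(m := Z)"])
    show "(X(m := Z)) i \<in> R" if "i < Suc m" for i
      using that X Z by (cases "i = m") (auto simp: m_def)
    show "chart_inner c ((X(m := Z)) i) ((X(m := Z)) j) \<noteq> 0 \<longleftrightarrow> i = j"
      if "i < Suc m" "j < Suc m" for i j
      using that XZ ZX ZZ orth by (cases "i = m"; cases "j = m") (simp_all add: m_def)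
  qed
  then show False by (simp add: m_def)
qed

text \<open>Gram-Schmidt, starting at each step from a frame section whose vector part at \<open>p\<close> is not yet in
  the span and shrinking the neighbourhood so that the new vector part does not vanish.\<close>

lemma orthogonal_sections:
  assumes c: "c \<in> man_atlas M" "p \<in> fst c"
    and U: "openin (man_top M) U" "p \<in> U"
    and s: "\<forall>i<k. smooth_section U (s i)"
    and frame: "\<forall>q\<in>U. span ((\<lambda>i::nat. s i q) ` {..<k}) = F q"
    and j: "j \<le> dim (fst ` F p)"
  shows "\<exists>V t. openin (man_top M) V \<and> p \<in> V \<and> V \<subseteq> U \<inter> fst c \<and>
      (\<forall>i<j. smooth_section V (t i) \<and> (\<forall>q\<in>V. t i q \<in> F q)) \<and>
      (\<forall>q\<in>V. \<forall>i<j. \<forall>i'<j. chart_inner c (fst (t i q)) (fst (t i' q)) \<noteq> 0 \<longleftrightarrow> i = i')"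
  using j
proof (induction j)
  case 0
  have "openin (man_top M) (U \<inter> fst c)"
    using U openin_chart_domain[OF c(1)] by auto
  then show ?case
    using U(2) c(2) by (intro exI[of _ "U \<inter> fst c"]) auto
next
  case (Suc j)
  then obtain V t where V: "openin (man_top M) V" "p \<in> V" "V \<subseteq> U \<inter> fst c"
    and t: "\<forall>i<j. smooth_section V (t i) \<and> (\<forall>q\<in>V. t i q \<in> F q)"
    and orth: "\<forall>q\<in>V. \<forall>i<j. \<forall>i'<j. chart_inner c (fst (t i q)) (fst (t i' q)) \<noteq> 0 \<longleftrightarrow> i = i'"
    by (metis Suc_leD)
  let ?X = "\<lambda>i q. fst (t i q)"
  \<comment> \<open>Otherwise \<open>j\<close> vectors would span the projected fibre at
    \<open>p\<close>, whose dimension is at least \<open>Suc j\<close>.\<close>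
  have "\<exists>i<k. fst (s i p) \<notin> span ((\<lambda>i. ?X i p) ` {..<j})"
  proof (rule ccontr)
    assume "\<not> ?thesis"
    then have "\<forall>i<k. fst (s i p) \<in> span ((\<lambda>i. ?X i p) ` {..<j})"
      by blast
    then have "fst ` (\<lambda>i. s i p) ` {..<k} \<subseteq> span ((\<lambda>i. ?X i p) ` {..<j})"
      unfolding image_image by (intro image_subsetI) simp
    moreover have "fst ` F p = span (fst ` (\<lambda>i. s i p) ` {..<k})"
      unfolding frame[rule_format, OF U(2), symmetric] by (rule span_linear_image[symmetric]) (simp add: linearI)
    ultimately have "fst ` F p \<subseteq> span ((\<lambda>i. ?X i p) ` {..<j})"
      by (simp only: span_minimal[OF _ subspace_span])
    then have "dim (fst ` F p) \<le> card ((\<lambda>i. ?X i p) ` {..<j})"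
      by (rule dim_le_card) simp
    also have "\<dots> \<le> j"
      using card_image_le[of "{..<j}"] by simp
    finally show False using Suc.prems by simp
  qed
  then obtain i where i: "i < k" "fst (s i p) \<notin> span ((\<lambda>i. ?X i p) ` {..<j})"
    by blast
  \<comment> \<open>Minus the projection coefficient. The correction is applied to the whole
    section, covector part included, so that the result stays in the fibres
    \<open>F q\<close>.\<close>
  define f where "f b q = - chart_inner c (?X b q) (fst (s i q)) / chart_inner c (?X b q) (?X b q)"
    for b q
  define t' where "t' q = s i q + (\<Sum>b<j. f b q *\<^sub>R t b q)" for q
  have sV: "smooth_section V (s i)"
    using s[rule_format, OF i(1)] V(3) by (auto intro: smooth_section_subset)
  have Vc: "V \<subseteq> fst c" using V(3) by blast
  have f: "smooth_fun M V (f b)" if b: "b < j" for b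
  proof -
    have "smooth_fun M V (\<lambda>q. (-1) * chart_inner c (?X b q) (fst (s i q)) / chart_inner c (?X b q) (?X b q))"
      using sV t b orth unfolding smooth_section_def
      by (intro smooth_fun_divide smooth_fun_mult smooth_fun_const smooth_fun_chart_inner c(1) V(1) Vc)
        auto
    then show ?thesis unfolding f_def by simp
  qed
  have t'_smooth: "smooth_section V t'"
    unfolding t'_def using t f by (intro smooth_section_add_sum V(1) sV) auto
  have t'_F: "t' q \<in> F q" if q: "q \<in> V" for q
  proof -
    have qU: "q \<in> U" using V(3) q by blast
    have "subspace (F q)"
      unfolding frame[rule_format, OF qU, symmetric] by (rule subspace_span)
    moreover have "s i q \<in> F q"
      unfolding frame[rule_format, OF qU, symmetric] using i(1) by (intro span_base) auto
    ultimately show ?thesis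
      unfolding t'_def using t q by (intro subspace_add subspace_sum subspace_scale) auto
  qed
  have fst_t': "fst (t' q) = fst (s i q) + (\<Sum>b<j. f b q *\<^sub>R ?X b q)" for q
    by (simp only: t'_def fst_add fst_sum fst_scaleR)
  have perp: "chart_inner c (?X a q) (fst (t' q)) = 0" if q: "q \<in> V" and a: "a < j" for q a
  proof -
    have "(\<Sum>b<j. f b q * chart_inner c (?X a q) (?X b q)) =
        (\<Sum>b<j. if b = a then f a q * chart_inner c (?X a q) (?X a q) else 0)"
      using orth q a by (intro sum.cong) auto
    also have "\<dots> = - chart_inner c (?X a q) (fst (s i q))"
      using a orth q by (simp add: f_def)
    finally show ?thesis
      by (simp add: fst_t' chart_inner_linear)
  qed
  define V' where "V' = {q \<in> V. chart_inner c (fst (t' q)) (fst (t' q)) \<noteq> 0}"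
  have "openin (man_top M) V'"
    unfolding V'_def using t'_smooth unfolding smooth_section_def
    by (intro openin_smooth_fun_nonzero[OF c(1) V(1) Vc] smooth_fun_chart_inner c(1) V(1) Vc) auto
  moreover have "p \<in> V'"
  proof -
    have "fst (t' p) \<noteq> 0"
    proof
      assume "fst (t' p) = 0"
      then have "fst (s i p) = - (\<Sum>b<j. f b p *\<^sub>R ?X b p)"
        unfolding fst_t' by (simp only: eq_neg_iff_add_eq_0)
      also have "\<dots> \<in> span ((\<lambda>i. ?X i p) ` {..<j})"
        by (intro span_neg span_sum span_scale span_base) auto
      finally show False using i(2) by contradiction
    qed
    moreover have "fst (t' p) \<in> tangent_space M p"
      using t'_smooth V(2) by (auto simp: smooth_section_def smooth_vector_field_def)
    ultimately show ?thesis
      using V(2) chart_inner_self_eq_0[OF c] by (auto simp: V'_def)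
  qed
  moreover have V'V: "V' \<subseteq> V" by (auto simp: V'_def)
  moreover have "smooth_section V' ((t(j := t')) a) \<and> (\<forall>q\<in>V'. (t(j := t')) a q \<in> F q)"
    if a: "a < Suc j" for a
  proof (cases "a = j")
    case True
    then show ?thesis
      using t'_smooth t'_F V'V smooth_section_subset by auto
  next
    case False
    then have "a < j" using a by simp
    then show ?thesis
      using t V'V False smooth_section_subset[of V "t a" V'] by auto
  qed
  moreover have "chart_inner c (fst ((t(j := t')) a q)) (fst ((t(j := t')) b q)) \<noteq> 0 \<longleftrightarrow> a = b"
    if q: "q \<in> V'" and "a < Suc j" "b < Suc j" for q a b
  proof -
    have qV: "q \<in> V" "chart_inner c (fst (t' q)) (fst (t' q)) \<noteq> 0"
      using q by (auto simp: V'_def)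
    then show ?thesis
      using that(2,3) orth perp[OF qV(1)] perp[OF qV(1), unfolded chart_inner_commute[of c "?X _ q"]]
      by (cases "a = j"; cases "b = j") auto
  qed
  ultimately show ?case
    using V(3) by (intro exI[of _ V'] exI[of _ "t(j := t')"]) blast
qed

section \<open>Fibres of almost Dirac structures and the local 2-form\<close>

lemma almost_dirac_fibre:
  assumes "almost_dirac M L" "q \<in> topspace (man_top M)"
  shows "subspace (L `` {q})" "(X, \<alpha>) \<in> L `` {q} \<Longrightarrow> X \<in> tangent_space M q"
    "(X, \<alpha>) \<in> L `` {q} \<Longrightarrow> \<alpha> \<in> cotangent_space M q"
    "(X, \<alpha>) \<in> L `` {q} \<Longrightarrow> (Y, \<beta>) \<in> L `` {q} \<Longrightarrow> \<alpha> Y = - \<beta> X"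
proof -
  have max: "maximal_isotropic M q (L `` {q})"
    using assms by (simp add: almost_dirac_def)
  show "subspace (L `` {q})"
    using max by (simp add: maximal_isotropic_def)
  have sub: "L `` {q} \<subseteq> tangent_space M q \<times> cotangent_space M q"
    using max by (simp add: maximal_isotropic_def)
  show "(X, \<alpha>) \<in> L `` {q} \<Longrightarrow> X \<in> tangent_space M q"
    "(X, \<alpha>) \<in> L `` {q} \<Longrightarrow> \<alpha> \<in> cotangent_space M q"
    using sub by (auto dest!: subsetD)
  show "\<alpha> Y = - \<beta> X" if "(X, \<alpha>) \<in> L `` {q}" "(Y, \<beta>) \<in> L `` {q}"
  proof -
    have "dirac_pairing (X, \<alpha>) (Y, \<beta>) = 0"
      using max that unfolding maximal_isotropic_def isotropic_def by blast
    then show ?thesis by (simp add: dirac_pairing_def)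
  qed
qed

text \<open>Since \<delta> vanishes on all vector parts of the fibre, adding the line through
  \<open>(0, \<delta>)\<close> preserves isotropy; by maximality the line already lies in the
  fibre.\<close>

lemma almost_dirac_add_annihilator:
  assumes L: "almost_dirac M L" "q \<in> topspace (man_top M)"
    and \<delta>: "\<delta> \<in> cotangent_space M q" "\<And>Y. Y \<in> pr1 L `` {q} \<Longrightarrow> \<delta> Y = 0"
    and X: "(q, X, \<alpha>) \<in> L"
  shows "(q, X, \<alpha> + \<delta>) \<in> L"
proof -
  note fibre = almost_dirac_fibre[OF L]
  define W' where "W' = {x + y | x y. x \<in> L `` {q} \<and> y \<in> range (\<lambda>r. r *\<^sub>R (0 :: 'a tangent, \<delta>))}"
  have max: "\<And>W. subspace W \<Longrightarrow> W \<subseteq> tangent_space M q \<times> cotangent_space M q \<Longrightarrow>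
      isotropic W \<Longrightarrow> L `` {q} \<subseteq> W \<Longrightarrow> W = L `` {q}"
    using L unfolding almost_dirac_def maximal_isotropic_def by blast
  have W'_iff: "(Y, \<beta>) \<in> W' \<longleftrightarrow> (\<exists>\<beta>' r. (Y, \<beta>') \<in> L `` {q} \<and> \<beta> = \<beta>' + r *\<^sub>R \<delta>)" for Y \<beta>
    by (force simp: W'_def)
  have \<delta>_0: "\<delta> Y = 0" if "(Y, \<beta>) \<in> L `` {q}" for Y \<beta>
    using imageI[OF that, of fst] by (intro \<delta>(2)) (simp only: pr1_fibre fst_conv)
  have "subspace W'"
    unfolding W'_def span_singleton[symmetric] by (intro subspace_sums fibre(1) subspace_span)
  moreover have "W' \<subseteq> tangent_space M q \<times> cotangent_space M q"
  proof
    fix w assume w: "w \<in> W'"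
    obtain Y \<beta> where "w = (Y, \<beta>)" by (cases w)
    with w have "(Y, \<beta>) \<in> W'" by simp
    then obtain \<beta>' r where "(Y, \<beta>') \<in> L `` {q}" "\<beta> = \<beta>' + r *\<^sub>R \<delta>"
      unfolding W'_iff by (elim exE conjE) (rule that)
    then show "w \<in> tangent_space M q \<times> cotangent_space M q"
      using fibre(2,3) \<delta>(1) \<open>w = (Y, \<beta>)\<close>
      by (intro SigmaI[of Y _ \<beta>, folded \<open>w = (Y, \<beta>)\<close>]) auto
  qed
  moreover have "isotropic W'"
    unfolding isotropic_def
  proof (intro ballI)
    fix u w assume u: "u \<in> W'" and w: "w \<in> W'"
    obtain Y \<beta> where uY: "u = (Y, \<beta>)" by (cases u)
    obtain Z \<gamma> where wZ: "w = (Z, \<gamma>)" by (cases w)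
    obtain \<beta>' r where \<beta>': "(Y, \<beta>') \<in> L `` {q}" "\<beta> = \<beta>' + r *\<^sub>R \<delta>"
      using u unfolding uY W'_iff by (elim exE conjE) (rule that)
    obtain \<gamma>' t where \<gamma>': "(Z, \<gamma>') \<in> L `` {q}" "\<gamma> = \<gamma>' + t *\<^sub>R \<delta>"
      using w unfolding wZ W'_iff by (elim exE conjE) (rule that)
    show "dirac_pairing u w = 0"
      using fibre(4)[OF \<beta>'(1) \<gamma>'(1)] \<delta>_0[OF \<beta>'(1)] \<delta>_0[OF \<gamma>'(1)]
      by (simp add: uY wZ \<beta>'(2) \<gamma>'(2) dirac_pairing_def plus_fun_apply scaleR_fun_apply)
  qed
  moreover have "L `` {q} \<subseteq> W'"
  proof
    fix w assume w: "w \<in> L `` {q}"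
    obtain Y \<beta> where "w = (Y, \<beta>)" by (cases w)
    with w show "w \<in> W'"
      by (simp add: W'_iff) (intro exI[of _ \<beta>] exI[of _ 0], simp)
  qed
  ultimately have "W' = L `` {q}" by (rule max)
  moreover have "(X, \<alpha> + \<delta>) \<in> W'"
    unfolding W'_iff using X by (intro exI[of _ \<alpha>] exI[of _ 1]) simp
  ultimately show ?thesis by simp
qed

lemma subbundle_frame:
  assumes "subbundle M L" "p \<in> topspace (man_top M)"
  obtains U k s where "openin (man_top M) U" "p \<in> U" "\<forall>i::nat<k. smooth_section U (s i)"
    "\<forall>q\<in>U. span ((\<lambda>i. s i q) ` {..<k}) = L `` {q}"
proof -
  have "\<exists>U k s. openin (man_top M) U \<and> p \<in> U \<and> (\<forall>i::nat<k. smooth_section U (s i)) \<and>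
      (\<forall>q\<in>U. inj_on (\<lambda>i. s i q) {..<k} \<and> independent ((\<lambda>i. s i q) ` {..<k}) \<and>
        span ((\<lambda>i. s i q) ` {..<k}) = L `` {q})"
    using assms unfolding subbundle_def smooth_section_def by (elim conjE) (rule bspec)
  then show thesis
    unfolding ball_conj_distrib by (elim exE conjE) (rule that)
qed

lemma regular_dirac_local_2form:
  assumes L: "almost_dirac M L" and r: "\<And>q. q \<in> topspace (man_top M) \<Longrightarrow> dim (pr1 L `` {q}) = r"
    and p: "p \<in> topspace (man_top M)"
  shows "\<exists>U B. openin (man_top M) U \<and> p \<in> U \<and> smooth_2form_on U B \<and>
    (\<forall>q\<in>U. \<forall>X \<alpha> Y. (q, X, \<alpha>) \<in> L \<longrightarrow> (q, Y) \<in> pr1 L \<longrightarrow> B q X Y = \<alpha> Y)"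
proof -
  have "subbundle M L"
    using L by (simp add: almost_dirac_def)
  then obtain U k s where U: "openin (man_top M) U" "p \<in> U"
    and s: "\<forall>i::nat<k. smooth_section U (s i)"
    and frame: "\<forall>q\<in>U. span ((\<lambda>i. s i q) ` {..<k}) = L `` {q}"
    using p by (rule subbundle_frame) (rule that)
  obtain c where c: "c \<in> man_atlas M" "p \<in> fst c"
    using chart_exists[OF p] .
  have "r \<le> dim (fst ` (L `` {p}))"
    using r[OF p] by (simp add: pr1_fibre)
  from orthogonal_sections[OF c U s frame this]
  obtain V t where V: "openin (man_top M) V" "p \<in> V" "V \<subseteq> U \<inter> fst c"
    and t: "\<forall>i<r. smooth_section V (t i) \<and> (\<forall>q\<in>V. t i q \<in> L `` {q})"
    and orth: "\<forall>q\<in>V. \<forall>i<r. \<forall>i'<r.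
      chart_inner c (fst (t i q)) (fst (t i' q)) \<noteq> 0 \<longleftrightarrow> i = i'"
    by (elim exE conjE) (rule that)
  have Vc: "V \<subseteq> fst c" and VU: "V \<subseteq> U" and VT: "V \<subseteq> topspace (man_top M)"
    using V(3) openin_subset[OF V(1)] by auto
  define X where "X i q = fst (t i q)" for i q
  define \<xi> where "\<xi> i q = snd (t i q)" for i q
  \<comment> \<open>The \<open>i\<close>-th coefficient of the orthogonal projection of
    \<open>Y\<close> onto the span of the frame. The form \<open>b\<close> below is \<omega>
    evaluated on the projections of both arguments, and \<open>A\<close> is the matrix of \<omega>
    in the frame.\<close>
  define G where "G i q Y = chart_inner c (X i q) Y / chart_inner c (X i q) (X i q)" for i q Y
  define A where "A i j q = \<xi> i q (X j q)" for i j q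
  define b where "b q Y Z = (\<Sum>i<r. \<Sum>j<r. A i j q * (G i q Y * G j q Z))" for q Y Z
  \<comment> \<open>Covectors are 0 outside the tangent space by convention, hence the case
    distinction.\<close>
  define B where "B q Y = (\<lambda>Z. if Z \<in> tangent_space M q then b q Y Z else 0)" for q Y
  have orth_X: "chart_inner c (X i q) (X i q) \<noteq> 0" if "i < r" "q \<in> V" for i q
    using orth that by (simp add: X_def)
  have t_mem: "(X i q, \<xi> i q) \<in> L `` {q}" if "i < r" "q \<in> V" for i q
    using t that unfolding X_def \<xi>_def prod.collapse by blast
  have X_tangent: "X i q \<in> tangent_space M q" if "i < r" "q \<in> V" for i q
    using almost_dirac_fibre(2)[OF L _ t_mem[OF that]] VT that(2) by blast
  have \<xi>_cotangent: "\<xi> i q \<in> cotangent_space M q" if "i < r" "q \<in> V" for i q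
    using almost_dirac_fibre(3)[OF L _ t_mem[OF that]] VT that(2) by blast
  have skew: "A i j q = - A j i q" if "i < r" "j < r" "q \<in> V" for i j q
    unfolding A_def using VT that
    by (intro almost_dirac_fibre(4)[OF L _ t_mem t_mem]) auto
  have G_add: "G i q (Y + Z) = G i q Y + G i q Z" and G_scale: "G i q (u *\<^sub>R Y) = u * G i q Y"
    for i q Y Z u by (simp_all add: G_def chart_inner_linear add_divide_distrib)
  have b_add: "b q (Y + Z) W = b q Y W + b q Z W" "b q W (Y + Z) = b q W Y + b q W Z"
    and b_scale: "b q (u *\<^sub>R Y) W = u * b q Y W" "b q W (u *\<^sub>R Y) = u * b q W Y" for q Y Z W u
    unfolding b_def G_add G_scale
    by (simp_all add: sum_distrib_left sum.distrib[symmetric] distrib_left distrib_right ac_simps)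
  \<comment> \<open>Exchanging the two summations and using skewness of \<open>A\<close> gives
    \<open>b q Y Y = - b q Y Y\<close>.\<close>
  have b_alt: "b q Y Y = 0" if q: "q \<in> V" for q Y
  proof -
    have "b q Y Y = (\<Sum>j<r. \<Sum>i<r. A i j q * (G i q Y * G j q Y))"
      unfolding b_def by (rule sum.swap)
    also have "\<dots> = (\<Sum>j<r. \<Sum>i<r. - (A j i q * (G j q Y * G i q Y)))"
    proof (intro sum.cong refl)
      fix i j assume "j \<in> {..<r}" "i \<in> {..<r}"
      then have "A i j q = - A j i q" using q by (intro skew) auto
      then show "A i j q * (G i q Y * G j q Y) = - (A j i q * (G j q Y * G i q Y))"
        by (simp add: mult.commute)
    qed
    also have "\<dots> = - b q Y Y"
      by (simp add: b_def sum_negf)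
    finally show ?thesis by simp
  qed
  have "smooth_2form_on V B"
  proof (rule smooth_2form_onI)
    fix q assume q: "q \<in> V"
    show "alternating_at q (B q)"
      unfolding alternating_at_def
    proof (intro conjI ballI allI)
      fix Y Z u assume Y: "Y \<in> tangent_space M q" and Z: "Z \<in> tangent_space M q"
      show "B q Y \<in> cotangent_space M q"
        unfolding cotangent_space_def B_def by (auto simp: b_add b_scale)
      show "B q (Y + Z) = B q Y + B q Z"
        by (rule ext) (simp add: B_def b_add plus_fun_apply)
      show "B q (u *\<^sub>R Y) = u *\<^sub>R B q Y"
        by (rule ext) (simp add: B_def b_scale scaleR_fun_apply)
      show "B q Y Y = 0"
        using Y b_alt[OF q] by (simp add: B_def)
    qed
  next
    fix W Y Z assume W: "openin (man_top M) W" "W \<subseteq> V" and Y: "smooth_vector_field M W Y"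
      and Z: "smooth_vector_field M W Z"
    have Wc: "W \<subseteq> fst c" using W(2) Vc by blast
    have X_W: "smooth_vector_field M W (X i)" and \<xi>_W: "smooth_1form M W (\<xi> i)" if "i < r" for i
      using smooth_section_subset[OF _ W(2), of "t i"] t that
      by (simp_all add: smooth_section_def X_def[abs_def] \<xi>_def[abs_def])
    have A_W: "smooth_fun M W (A i j)" if "i < r" "j < r" for i j
      unfolding A_def[abs_def] by (rule smooth_fun_1form[OF \<xi>_W[OF that(1)] W(1) X_W[OF that(2)]])
    have G_W: "smooth_fun M W (\<lambda>q. G i q (Y' q))" if i: "i < r" and "smooth_vector_field M W Y'"
      for i Y'
      unfolding G_def using that(2) X_W[OF i] orth_X[OF i] W(2)
      by (intro smooth_fun_divide smooth_fun_chart_inner c(1) W(1) Wc) auto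
    have "smooth_fun M W (\<lambda>q. b q (Y q) (Z q))"
      unfolding b_def by (intro smooth_fun_sum smooth_fun_mult A_W G_W W(1) Y Z) auto
    then show "smooth_fun M W (\<lambda>q. B q (Y q) (Z q))"
      by (rule smooth_fun_cong[OF W(1), rotated])
        (use Z in \<open>simp add: B_def smooth_vector_field_def\<close>)
  qed
  moreover have "B q Y Z = \<eta> Z" if q: "q \<in> V" and Y: "(q, Y, \<eta>) \<in> L" and Z_pr1: "(q, Z) \<in> pr1 L"
    for q Y \<eta> Z
  proof -
    obtain \<zeta> where Z: "(Z, \<zeta>) \<in> L `` {q}"
      using Z_pr1 by (auto simp: pr1_def)
    have Y': "(Y, \<eta>) \<in> L `` {q}" using Y by simp
    have qT: "q \<in> topspace (man_top M)" and qU: "q \<in> U" and qc: "q \<in> fst c"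
      using q VT VU Vc by auto
    note fibre = almost_dirac_fibre[OF L qT]
    let ?R = "fst ` (L `` {q})"
    have dimR: "dim ?R = r"
      using r[OF qT] by (simp add: pr1_fibre)
    have lin: "linear (fst :: 'a tangent \<times> 'a cotangent \<Rightarrow> 'a tangent)"
      by (simp add: linearI)
    have R_span: "?R \<subseteq> span (fst ` (\<lambda>i. s i q) ` {..<k})"
      unfolding frame[rule_format, OF qU, symmetric] span_linear_image[OF lin] by simp
    have expand: "W = (\<Sum>i<r. G i q W *\<^sub>R X i q)" if "W \<in> ?R" for W
      unfolding G_def
    proof (rule orthogonal_expansion[OF c(1) qc _ _ R_span, unfolded dimR])
      show "subspace ?R"
        using fibre(1) by (rule linear_subspace_image[OF lin])
      show "?R \<subseteq> tangent_space M q" using fibre(2) by auto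
      show "X i q \<in> ?R" if "i < r" for i using t_mem[OF that q] by force
      show "chart_inner c (X i q) (X j q) \<noteq> 0 \<longleftrightarrow> i = j" if "i < r" "j < r" for i j
        using orth q that by (simp add: X_def)
      show "W \<in> ?R" by fact
    qed simp
    have "Y \<in> ?R" "Z \<in> ?R" using Y' Z by force+
    note YZ = this[THEN expand]
    have \<xi>Z: "\<xi> i q Z = (\<Sum>j<r. G j q Z * A i j q)" if "i < r" for i
      using cotangent_sum[OF \<xi>_cotangent[OF that q], of "{..<r}" "\<lambda>j. X j q" "\<lambda>j. G j q Z"]
        X_tangent q unfolding YZ(2)[symmetric] A_def by simp
    \<comment> \<open>The covectors \<eta> and \<zeta> need not be combinations of the frame
      covectors. Isotropy turns \<eta>(Z) into -\<zeta>(Y); after \<open>Y\<close> is expanded,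
      isotropy turns each \<open>- \<zeta> (X i q)\<close> back into \<open>\<xi> i q Z\<close>,
      which the expansion of \<open>Z\<close> reduces to entries of \<open>A\<close>.\<close>
    have "\<zeta> Y = (\<Sum>i<r. G i q Y * \<zeta> (X i q))"
      using cotangent_sum[OF fibre(3)[OF Z], of "{..<r}" "\<lambda>j. X j q" "\<lambda>j. G j q Y"]
        X_tangent q unfolding YZ(1)[symmetric] by simp
    then have "\<eta> Z = - (\<Sum>i<r. G i q Y * \<zeta> (X i q))"
      using fibre(4)[OF Y' Z] by simp
    also have "\<dots> = (\<Sum>i<r. G i q Y * \<xi> i q Z)"
      unfolding sum_negf[symmetric]
      using fibre(4)[OF t_mem[OF _ q] Z] by (intro sum.cong) auto
    also have "\<dots> = b q Y Z"
      unfolding b_def using \<xi>Z by (intro sum.cong) (auto simp: sum_distrib_left ac_simps)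
    finally show ?thesis
      using fibre(2)[OF Z] by (simp add: B_def)
  qed
  ultimately show ?thesis
    using V(1,2) by (intro exI[of _ V] exI[of _ B]) simp
qed

lemma regular_dirac_2form:
  assumes "regular_dirac M L"
  obtains B where "smooth_2form M B"
    "\<And>q X \<alpha> Y. (q, X, \<alpha>) \<in> L \<Longrightarrow> (q, Y) \<in> pr1 L \<Longrightarrow> B q X Y = \<alpha> Y"
proof -
  obtain r where L: "almost_dirac M L" "\<And>q. q \<in> topspace (man_top M) \<Longrightarrow> dim (pr1 L `` {q}) = r"
    using assms by (auto simp: regular_dirac_def)
  define \<Phi> where "\<Phi> q b \<longleftrightarrow> (\<forall>X \<alpha> Y. (q, X, \<alpha>) \<in> L \<longrightarrow> (q, Y) \<in> pr1 L \<longrightarrow> b X Y = \<alpha> Y)"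
    for q and b :: "'a tangent \<Rightarrow> 'a cotangent"
  have "\<exists>B. smooth_2form M B \<and> (\<forall>q\<in>topspace (man_top M). \<Phi> q (B q))"
  proof (rule glue_2forms)
    show "\<exists>U B. openin (man_top M) U \<and> p \<in> U \<and> smooth_2form_on U B \<and> (\<forall>q\<in>U. \<Phi> q (B q))"
      if "p \<in> topspace (man_top M)" for p
      unfolding \<Phi>_def by (rule regular_dirac_local_2form[OF L that])
    show "\<Phi> q ((1 - u) *\<^sub>R b + u *\<^sub>R b')" if "\<Phi> q b" "\<Phi> q b'" for q b b' u
      using that by (simp add: \<Phi>_def plus_fun_apply scaleR_fun_apply algebra_simps)
  qed
  moreover have "q \<in> topspace (man_top M)" if "(q, X, \<alpha>) \<in> L" for q X \<alpha>
    using L(1) that by (auto simp: almost_dirac_def subbundle_def double_bundle_def)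
  ultimately show thesis
    using that unfolding \<Phi>_def by metis
qed

end

section \<open>Gauge transformations and equal projections\<close>

lemma pr1_gauge_transform: "pr1 (gauge_transform B L) = pr1 L"
  by (force simp: pr1_def gauge_transform_def)

theorem theorem3p11:
  fixes P :: "'a manifold"
    and L\<^sub>1 L\<^sub>2 :: "('a \<times> 'a tangent \<times> 'a cotangent) set"
  assumes "smooth_manifold P"
    and "regular_dirac P L\<^sub>1"
    and "regular_dirac P L\<^sub>2"
  shows "gauge_related P L\<^sub>1 L\<^sub>2 \<longleftrightarrow> pr1 L\<^sub>1 = pr1 L\<^sub>2"
proof
  assume "gauge_related P L\<^sub>1 L\<^sub>2"
  then show "pr1 L\<^sub>1 = pr1 L\<^sub>2"
    unfolding gauge_related_def using pr1_gauge_transform by metis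
next
  assume pr1: "pr1 L\<^sub>1 = pr1 L\<^sub>2"
  interpret smooth_mfd P
    by standard fact
  obtain B\<^sub>1 where B\<^sub>1: "smooth_2form P B\<^sub>1"
    "\<And>q X \<alpha> Y. (q, X, \<alpha>) \<in> L\<^sub>1 \<Longrightarrow> (q, Y) \<in> pr1 L\<^sub>1 \<Longrightarrow> B\<^sub>1 q X Y = \<alpha> Y"
    by (rule regular_dirac_2form[OF assms(2)]) (rule that, assumption, blast)
  obtain B\<^sub>2 where B\<^sub>2: "smooth_2form P B\<^sub>2"
    "\<And>q X \<alpha> Y. (q, X, \<alpha>) \<in> L\<^sub>2 \<Longrightarrow> (q, Y) \<in> pr1 L\<^sub>2 \<Longrightarrow> B\<^sub>2 q X Y = \<alpha> Y"
    by (rule regular_dirac_2form[OF assms(3)]) (rule that, assumption, blast)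
  \<comment> \<open>The difference is written as a combination with constant coefficients to match
    \<open>smooth_2form_on_lincomb\<close>.\<close>
  define B where "B q = 1 *\<^sub>R B\<^sub>2 q + (- 1) *\<^sub>R B\<^sub>1 q" for q
  have B_apply: "B q X = B\<^sub>2 q X - B\<^sub>1 q X" for q X
    by (simp add: B_def plus_fun_apply scaleR_fun_apply)
  have B: "smooth_2form P B"
    using B\<^sub>1(1) B\<^sub>2(1) unfolding smooth_2form_iff B_def
    by (intro smooth_2form_on_lincomb smooth_fun_const)
  have ad: "almost_dirac P L\<^sub>1" "almost_dirac P L\<^sub>2"
    using assms by (auto simp: regular_dirac_def)
  have base: "q \<in> topspace (man_top P)" if "(q, X, \<alpha>) \<in> L\<^sub>1" for q X \<alpha>
    using ad(1) that by (auto simp: almost_dirac_def subbundle_def double_bundle_def)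
  \<comment> \<open>On the common projection, \<open>B q X\<close> changes any covector of the first
    structure over \<open>X\<close> into the restriction of any covector of the second over
    \<open>X\<close>.\<close>
  have key: "B q X \<in> cotangent_space P q" "\<alpha>\<^sub>1 \<in> cotangent_space P q" "\<alpha>\<^sub>2 \<in> cotangent_space P q"
    "\<And>Y. Y \<in> pr1 L\<^sub>1 `` {q} \<Longrightarrow> (\<alpha>\<^sub>1 + B q X) Y = \<alpha>\<^sub>2 Y"
    if "(q, X, \<alpha>\<^sub>1) \<in> L\<^sub>1" "(q, X, \<alpha>\<^sub>2) \<in> L\<^sub>2" for q X \<alpha>\<^sub>1 \<alpha>\<^sub>2
  proof -
    note q = base[OF that(1)]
    have "X \<in> tangent_space P q"
      using almost_dirac_fibre(2)[OF ad(1) q] that(1) by blast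
    then show "B q X \<in> cotangent_space P q"
      using B q unfolding smooth_2form_def by blast
    show "\<alpha>\<^sub>1 \<in> cotangent_space P q" "\<alpha>\<^sub>2 \<in> cotangent_space P q"
      using almost_dirac_fibre(3)[OF ad(1) q] almost_dirac_fibre(3)[OF ad(2) q] that by blast+
    show "(\<alpha>\<^sub>1 + B q X) Y = \<alpha>\<^sub>2 Y" if "Y \<in> pr1 L\<^sub>1 `` {q}" for Y
      using B\<^sub>1(2)[OF \<open>(q, X, \<alpha>\<^sub>1) \<in> L\<^sub>1\<close>] B\<^sub>2(2)[OF \<open>(q, X, \<alpha>\<^sub>2) \<in> L\<^sub>2\<close>] that pr1
      by (simp add: B_apply plus_fun_apply)
  qed
  have "gauge_transform B L\<^sub>1 = L\<^sub>2"
  proof (rule set_eqI)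
    fix z :: "'a \<times> 'a tangent \<times> 'a cotangent"
    obtain q X \<alpha> where z: "z = (q, X, \<alpha>)" by (cases z)
    show "z \<in> gauge_transform B L\<^sub>1 \<longleftrightarrow> z \<in> L\<^sub>2"
    proof
      assume "z \<in> gauge_transform B L\<^sub>1"
      then obtain \<alpha>\<^sub>1 where \<alpha>\<^sub>1: "(q, X, \<alpha>\<^sub>1) \<in> L\<^sub>1" "\<alpha> = \<alpha>\<^sub>1 + B q X"
        by (auto simp: gauge_transform_def z)
      have "(q, X) \<in> pr1 L\<^sub>2"
        unfolding pr1[symmetric] using \<alpha>\<^sub>1(1) by (force simp: pr1_def)
      then obtain \<alpha>\<^sub>2 where \<alpha>\<^sub>2: "(q, X, \<alpha>\<^sub>2) \<in> L\<^sub>2"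
        by (auto simp: pr1_def)
      note k = key[OF \<alpha>\<^sub>1(1) \<alpha>\<^sub>2]
      \<comment> \<open>The covector \<alpha> is compared with some \<open>\<alpha>\<^sub>2\<close>
        known to lie over \<open>X\<close> in \<open>L\<^sub>2\<close>; their difference annihilates
        the projection.\<close>
      have "(q, X, \<alpha>\<^sub>2 + (\<alpha> - \<alpha>\<^sub>2)) \<in> L\<^sub>2"
      proof (rule almost_dirac_add_annihilator[OF ad(2) base[OF \<alpha>\<^sub>1(1)] _ _ \<alpha>\<^sub>2])
        show "\<alpha> - \<alpha>\<^sub>2 \<in> cotangent_space P q"
          unfolding \<alpha>\<^sub>1(2) using k(1-3) by (intro cotangent_space_closed)
        show "(\<alpha> - \<alpha>\<^sub>2) Y = 0" if "Y \<in> pr1 L\<^sub>2 `` {q}" for Y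
          using k(4)[of Y] that unfolding pr1 \<alpha>\<^sub>1(2) by simp
      qed
      then show "z \<in> L\<^sub>2" by (simp add: z)
    next
      assume "z \<in> L\<^sub>2"
      then have \<alpha>: "(q, X, \<alpha>) \<in> L\<^sub>2" by (simp add: z)
      then have "(q, X) \<in> pr1 L\<^sub>1"
        unfolding pr1 by (force simp: pr1_def)
      then obtain \<alpha>\<^sub>1 where \<alpha>\<^sub>1: "(q, X, \<alpha>\<^sub>1) \<in> L\<^sub>1"
        by (auto simp: pr1_def)
      note k = key[OF \<alpha>\<^sub>1 \<alpha>]
      \<comment> \<open>The only possible preimage of \<open>z\<close> has covector
        \<open>\<alpha> - B q X\<close>; it differs from the given \<open>\<alpha>\<^sub>1\<close>
        by an annihilator of the projection.\<close>
      have "(q, X, \<alpha>\<^sub>1 + (\<alpha> - B q X - \<alpha>\<^sub>1)) \<in> L\<^sub>1"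
      proof (rule almost_dirac_add_annihilator[OF ad(1) base[OF \<alpha>\<^sub>1] _ _ \<alpha>\<^sub>1])
        show "\<alpha> - B q X - \<alpha>\<^sub>1 \<in> cotangent_space P q"
          using k(1-3) by (intro cotangent_space_closed)
        show "(\<alpha> - B q X - \<alpha>\<^sub>1) Y = 0" if "Y \<in> pr1 L\<^sub>1 `` {q}" for Y
          using k(4)[OF that] by simp
      qed
      then have "(q, X, \<alpha> - B q X) \<in> L\<^sub>1" by simp
      moreover have "\<alpha> = (\<alpha> - B q X) + B q X" by simp
      ultimately show "z \<in> gauge_transform B L\<^sub>1"
        unfolding gauge_transform_def z by blast
    qed
  qed
  with B show "gauge_related P L\<^sub>1 L\<^sub>2"
    unfolding gauge_related_def by blast
qed

end
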